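(* Let $G$ be a graph of order $n$. (a) $c(G)+\overline c(G)=n+1$ if and only if $G$ is $K_1$-like. (b) $c(G)+\overline c(G)=n+2$ if and only if $G$ is $P_4$-like, $C_4$-like, or $\overline C_4$-like.
   Context: Graphs are finite and simple with nonempty vertex set $V(G)$ and edge set $E(G)$; the order of $G$ is $|V(G)|$, and $\overline G$ denotes the complement of $G$. A clique is a set of pairwise adjacent vertices, an anticlique is a set of pairwise non-adjacent vertices (sets with at most one vertex are both). Maximal means maximal with respect to inclusion. $c(G)$ is the number of maximal cliques of $G$ and $\overline c(G)=c(\overline G)$ is the number of maximal anticliques of $G$. A graph $G$ is $K_1$-like if $V(G)=X\cup Y$ where $X$ is a clique, $Y$ is an anticlique, and $X\cap Y\neq\varnothing$. A graph $G$ is $P_4$-like if $V(G)=X\cup Y$ where $X$ is a maximal clique, $Y$ is a maximal anticlique, and $X\cap Y=\varnothing$. A graph $G$ is $C_4$-like if there is a $4$-element set $U=\{p,q,r,s\}\subseteq V(G)$ such that $pq,qr,rs,ps\in E(G)$ while $pr,qs\notin E(G)$, and $V(G)\setminus U=X\cup Y$ where $X$ is a clique and $Y$ is an anticlique ($X$, $Y$ possibly empty), each vertex in $X$ is joined to $p$ and $q$ and at least one more vertex in $U$, and no vertex in $Y$ is joined to any vertex in $U$. A graph $G$ is $\overline C_4$-like if $\overline G$ is $C_4$-like. *)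

theory Defs
  imports "HOL-Library.Ramsey"
begin

text \<open>
  A graph is a pair of a vertex set \<open>V\<close> and a set \<open>E\<close> of two-element subsets of \<open>V\<close>.
  The predicates \<open>clique\<close> and \<open>indep\<close> of \<open>HOL-Library.Ramsey\<close> do not confine their
  first argument to the vertex set, which is why this is added below.
\<close>

definition simple_graph :: "'a set \<Rightarrow> 'a set set \<Rightarrow> bool" where
  "simple_graph V E \<longleftrightarrow> finite V \<and> V \<noteq> {} \<and> E \<subseteq> [V]\<^bsup>2\<^esup>"

definition compl_edges :: "'a set \<Rightarrow> 'a set set \<Rightarrow> 'a set set" where
  "compl_edges V E = [V]\<^bsup>2\<^esup> - E"

definition is_clique :: "'a set \<Rightarrow> 'a set set \<Rightarrow> 'a set \<Rightarrow> bool" where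
  "is_clique V E X \<longleftrightarrow> X \<subseteq> V \<and> clique X E"

definition is_anticlique :: "'a set \<Rightarrow> 'a set set \<Rightarrow> 'a set \<Rightarrow> bool" where
  "is_anticlique V E Y \<longleftrightarrow> Y \<subseteq> V \<and> indep Y E"

definition maximal_clique :: "'a set \<Rightarrow> 'a set set \<Rightarrow> 'a set \<Rightarrow> bool" where
  "maximal_clique V E X \<longleftrightarrow>
     is_clique V E X \<and> (\<forall>X'. is_clique V E X' \<and> X \<subseteq> X' \<longrightarrow> X' = X)"

definition maximal_anticlique :: "'a set \<Rightarrow> 'a set set \<Rightarrow> 'a set \<Rightarrow> bool" where
  "maximal_anticlique V E Y \<longleftrightarrow>
     is_anticlique V E Y \<and> (\<forall>Y'. is_anticlique V E Y' \<and> Y \<subseteq> Y' \<longrightarrow> Y' = Y)"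

definition num_max_cliques :: "'a set \<Rightarrow> 'a set set \<Rightarrow> nat" where
  "num_max_cliques V E = card {X. maximal_clique V E X}"

definition num_max_anticliques :: "'a set \<Rightarrow> 'a set set \<Rightarrow> nat" where
  "num_max_anticliques V E = num_max_cliques V (compl_edges V E)"

definition K1_like :: "'a set \<Rightarrow> 'a set set \<Rightarrow> bool" where
  "K1_like V E \<longleftrightarrow>
     (\<exists>X Y. V = X \<union> Y \<and> is_clique V E X \<and> is_anticlique V E Y \<and> X \<inter> Y \<noteq> {})"

definition P4_like :: "'a set \<Rightarrow> 'a set set \<Rightarrow> bool" where
  "P4_like V E \<longleftrightarrow>
     (\<exists>X Y. V = X \<union> Y \<and> maximal_clique V E X \<and> maximal_anticlique V E Y \<and> X \<inter> Y = {})"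

definition C4_like :: "'a set \<Rightarrow> 'a set set \<Rightarrow> bool" where
  "C4_like V E \<longleftrightarrow>
     (\<exists>U p q r s. U = {p, q, r, s} \<and> card U = 4 \<and> U \<subseteq> V \<and>
        {p, q} \<in> E \<and> {q, r} \<in> E \<and> {r, s} \<in> E \<and> {p, s} \<in> E \<and>
        {p, r} \<notin> E \<and> {q, s} \<notin> E \<and>
        (\<exists>X Y. V - U = X \<union> Y \<and> is_clique V E X \<and> is_anticlique V E Y \<and>
           (\<forall>x\<in>X. {x, p} \<in> E \<and> {x, q} \<in> E \<and> (\<exists>u\<in>U - {p, q}. {x, u} \<in> E)) \<and>
           (\<forall>y\<in>Y. \<forall>u\<in>U. {y, u} \<notin> E)))"

definition co_C4_like :: "'a set \<Rightarrow> 'a set set \<Rightarrow> bool" where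
  "co_C4_like V E \<longleftrightarrow> C4_like V (compl_edges V E)"

end

theory Submission
  imports Defs
begin

text \<open>
  Write \<open>c\<close> and \<open>c'\<close> for the numbers of maximal cliques and maximal anticliques, and call
  \<open>g = c + c' - (n + 1)\<close> the excess of a graph on \<open>n\<close> vertices.  The theorem says which graphs have
  excess 0 and which have excess 1.

  \<^emph>\<open>The excess is never negative.\<close>  Let \<open>N\<close> and \<open>M\<close> be the sets of neighbours and of
  non-neighbours of a vertex \<open>v\<close>, both nonempty.  The maximal cliques through \<open>v\<close> are those of \<open>N\<close>
  with \<open>v\<close> added, and every maximal clique of \<open>M\<close> extends to a maximal clique that avoids \<open>v\<close>.
  Hence \<open>c(V) \<ge> c(N) + c(M)\<close>, likewise for anticliques, and since \<open>n = |N| + |M| + 1\<close> the excess of the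
  graph is at least the sum of the excesses of \<open>N\<close> and \<open>M\<close>
  (\<open>num_max_cliques_vertex_split\<close>, \<open>maximal_clique_sum_ge\<close>).

  \<^emph>\<open>Excess at most 1 forces domination.\<close>  If the excess is at most 1, then \<open>N\<close> or \<open>M\<close> has excess 0
  and the counting above is tight on that side.  By induction this part is \<open>K\<^sub>1\<close>-like, and that,
  together with tightness, gives nonadjacent vertices \<open>u\<close>, \<open>w\<close> such that every neighbour of \<open>u\<close> is a
  neighbour of \<open>w\<close>, in the graph or in its complement (\<open>dominated_exists\<close>).

  \<^emph>\<open>Deleting a dominated vertex.\<close>  The vertex \<open>w\<close> keeps every maximal clique of \<open>V - {u}\<close> maximal, so
  the excess drops by at least \<open>c(N(u)) - 1\<close>, plus the number of maximal anticliques through \<open>u\<close> that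
  are destroyed by the deletion of \<open>u\<close>.  As the excess is at most 1, the graph \<open>V - {u}\<close> is of a
  known shape by induction, and two things can happen: either \<open>u\<close> has pairwise adjacent neighbours and
  at most one anticlique is destroyed, or \<open>V - {u}\<close> is \<open>K\<^sub>1\<close>-like, \<open>N(u)\<close> has exactly two maximal
  cliques and no anticlique is destroyed.  If no anticlique is destroyed, then for every anticlique \<open>B\<close>
  through \<open>u\<close> and every neighbour \<open>u'\<close> of \<open>u\<close> there is a vertex \<open>a\<close> that fits \<open>B\<close> but is
  adjacent to \<open>u'\<close> (\<open>blocker_exists\<close>); well chosen \<open>B\<close> determine how \<open>u\<close> is attached to
  \<open>V - {u}\<close> (\<open>near_split_insert_dominated\<close>).

  Conversely, the numbers of maximal cliques of the graphs named in the theorem are computed exactly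
  by listing small cliques such that every maximal clique contains exactly one of them
  (\<open>num_max_cliques_eq\<close>).

  Induction runs over the vertex set with \<open>E\<close> fixed.  All notions depend only on which pairs of
  distinct vertices of \<open>V\<close> belong to \<open>E\<close>.  Hence \<open>E\<close> itself serves as the edge set of every induced
  subgraph and the set-theoretic complement \<open>- E\<close> as that of its complement, and every statement about
  cliques for all \<open>E\<close> is also one about anticliques.
\<close>

section \<open>Cliques and anticliques\<close>

definition adj :: "'a set set \<Rightarrow> 'a \<Rightarrow> 'a \<Rightarrow> bool" where
  "adj E a b \<longleftrightarrow> {a, b} \<in> E"

lemma adj_sym: "adj E a b \<longleftrightarrow> adj E b a"
  by (simp add: adj_def insert_commute)

lemma adj_compl [simp]: "adj (- E) a b \<longleftrightarrow> \<not> adj E a b"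
  by (simp add: adj_def)

lemma is_clique_iff:
  "is_clique V E X \<longleftrightarrow> X \<subseteq> V \<and> (\<forall>a\<in>X. \<forall>b\<in>X. a \<noteq> b \<longrightarrow> adj E a b)"
  by (simp add: is_clique_def clique_def adj_def)

lemma is_anticlique_iff: "is_anticlique V E Y \<longleftrightarrow> is_clique V (- E) Y"
  by (simp add: is_clique_def is_anticlique_def clique_def indep_def)

lemma is_clique_compl_edges: "is_clique V (compl_edges V E) X \<longleftrightarrow> is_clique V (- E) X"
  by (auto simp: is_clique_def compl_edges_def clique_def nsets_def card_insert_if)

lemma maximal_anticlique_iff: "maximal_anticlique V E Y \<longleftrightarrow> maximal_clique V (- E) Y"
  by (simp add: maximal_anticlique_def maximal_clique_def is_anticlique_iff)

lemma num_max_anticliques_eq: "num_max_anticliques V E = num_max_cliques V (- E)"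
  by (simp add: num_max_anticliques_def num_max_cliques_def maximal_clique_def
      is_clique_compl_edges)

lemma maximal_clique_iff:
  "maximal_clique V E K \<longleftrightarrow>
     is_clique V E K \<and> (\<forall>v \<in> V - K. \<exists>x\<in>K. \<not> adj E v x)"
proof
  assume K: "maximal_clique V E K"
  then have cl: "is_clique V E K" by (simp add: maximal_clique_def)
  have "\<exists>x\<in>K. \<not> adj E v x" if v: "v \<in> V - K" for v
  proof (rule ccontr)
    assume "\<not> ?thesis"
    then have "is_clique V E (insert v K)"
      using cl v by (auto simp: is_clique_iff) (metis adj_sym)
    then have "insert v K = K" using K unfolding maximal_clique_def by blast
    then show False using v by blast
  qed
  with cl show "is_clique V E K \<and> (\<forall>v \<in> V - K. \<exists>x\<in>K. \<not> adj E v x)" by blast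
next
  assume K: "is_clique V E K \<and> (\<forall>v \<in> V - K. \<exists>x\<in>K. \<not> adj E v x)"
  have "L = K" if L: "is_clique V E L" "K \<subseteq> L" for L
  proof -
    have "v \<in> K" if v: "v \<in> L" for v
    proof (rule ccontr)
      assume "v \<notin> K"
      moreover have "v \<in> V" using L(1) v by (auto simp: is_clique_iff)
      ultimately obtain x where x: "x \<in> K" "\<not> adj E v x" using K by blast
      then have "x \<in> L" "x \<noteq> v" using L(2) \<open>v \<notin> K\<close> by auto
      then show False using L(1) v x(2) by (simp add: is_clique_iff)
    qed
    then show ?thesis using L(2) by blast
  qed
  with K show "maximal_clique V E K" unfolding maximal_clique_def by blast
qed

lemma maximal_clique_is_clique: "maximal_clique V E K \<Longrightarrow> is_clique V E K"
  by (simp add: maximal_clique_def)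

lemma maximal_clique_subset: "maximal_clique V E K \<Longrightarrow> K \<subseteq> V"
  by (simp add: maximal_clique_def is_clique_def)

lemma maximal_cliqueD:
  "maximal_clique V E K \<Longrightarrow> a \<in> K \<Longrightarrow> b \<in> K \<Longrightarrow> a \<noteq> b \<Longrightarrow> adj E a b"
  by (simp add: maximal_clique_def is_clique_iff)

lemma maximal_clique_absorb:
  "maximal_clique V E K \<Longrightarrow> v \<in> V \<Longrightarrow> (\<And>x. x \<in> K \<Longrightarrow> x \<noteq> v \<Longrightarrow> adj E v x) \<Longrightarrow> v \<in> K"
  unfolding maximal_clique_iff by (metis DiffI)

lemma maximal_clique_subset_eq:
  "maximal_clique V E K \<Longrightarrow> is_clique V E L \<Longrightarrow> K \<subseteq> L \<Longrightarrow> L = K"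
  by (simp add: maximal_clique_def)

lemma finite_maximal_cliques: "finite V \<Longrightarrow> finite {K. maximal_clique V E K}"
  by (rule finite_subset[of _ "Pow V"]) (auto dest: maximal_clique_subset)

lemma maximal_clique_extends:
  assumes "finite V" "is_clique V E Q"
  shows "\<exists>K. maximal_clique V E K \<and> Q \<subseteq> K"
proof -
  have fin: "finite {K. is_clique V E K}"
    by (rule finite_subset[of _ "Pow V"]) (auto simp: is_clique_def assms(1))
  obtain K where "K \<in> {K. is_clique V E K}" "Q \<subseteq> K"
      "\<forall>L\<in>{K. is_clique V E K}. K \<subseteq> L \<longrightarrow> K = L"
    using finite_has_maximal2[OF fin, of Q] assms(2) by auto
  then show ?thesis by (auto simp: maximal_clique_def)
qed

lemma num_max_cliques_pos:
  assumes "finite V" shows "1 \<le> num_max_cliques V E"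
proof -
  have "{K. maximal_clique V E K} \<noteq> {}"
    using maximal_clique_extends[OF assms, of E "{}"] by (auto simp: is_clique_iff)
  then show ?thesis
    using finite_maximal_cliques[OF assms, of E]
    by (simp add: num_max_cliques_def Suc_le_eq card_gt_0_iff)
qed

text \<open>
  A maximal clique contains at most one member of \<open>F\<close>, and every member of \<open>F\<close> lies in some.
\<close>

lemma num_max_cliques_ge:
  assumes "finite V" and cl: "\<And>Q. Q \<in> F \<Longrightarrow> is_clique V E Q"
    and inc: "\<And>P Q. P \<in> F \<Longrightarrow> Q \<in> F \<Longrightarrow> P \<noteq> Q \<Longrightarrow> \<not> is_clique V E (P \<union> Q)"
  shows "card F \<le> num_max_cliques V E"
proof -
  have "\<forall>Q\<in>F. \<exists>K. maximal_clique V E K \<and> Q \<subseteq> K"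
    using maximal_clique_extends[OF assms(1)] cl by blast
  then obtain h where h: "\<And>Q. Q \<in> F \<Longrightarrow> maximal_clique V E (h Q) \<and> Q \<subseteq> h Q" by metis
  have "inj_on h F"
  proof (rule inj_onI, rule ccontr)
    fix P Q assume PQ: "P \<in> F" "Q \<in> F" "h P = h Q" "P \<noteq> Q"
    then have "P \<union> Q \<subseteq> h P" using h[of P] h[of Q] by auto
    then have "is_clique V E (P \<union> Q)"
      using h[OF PQ(1)] unfolding maximal_clique_def is_clique_iff by (meson subset_iff)
    then show False using inc PQ by blast
  qed
  then show ?thesis unfolding num_max_cliques_def
    using card_inj_on_le[of h F "{K. maximal_clique V E K}"]
      finite_maximal_cliques[OF assms(1), of E] h by auto
qed

text \<open>
  The vertices that can be added to a given member \<open>Q\<close> of \<open>F\<close> are pairwise adjacent, so \<open>Q\<close> lies in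
  at most one maximal clique.
\<close>

lemma num_max_cliques_le:
  assumes "finite F"
    and hit: "\<And>K. maximal_clique V E K \<Longrightarrow> \<exists>Q\<in>F. Q \<subseteq> K"
    and simplicial: "\<And>Q a b. Q \<in> F \<Longrightarrow> is_clique V E (insert a Q) \<Longrightarrow> is_clique V E (insert b Q)
        \<Longrightarrow> a \<noteq> b \<Longrightarrow> adj E a b"
  shows "num_max_cliques V E \<le> card F"
proof -
  obtain h where h: "\<And>K. maximal_clique V E K \<Longrightarrow> h K \<in> F \<and> h K \<subseteq> K" using hit by metis
  have sub: "K \<subseteq> L"
    if KL: "maximal_clique V E K" "maximal_clique V E L" "h K = h L" for K L
  proof
    fix a assume a: "a \<in> K"
    have cl: "is_clique V E (insert c (h M))" if "maximal_clique V E M" "c \<in> M" for c M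
      using that h[OF that(1)] unfolding maximal_clique_def is_clique_iff
      by (meson insert_subset subset_iff)
    show "a \<in> L"
    proof (rule maximal_clique_absorb[OF KL(2)])
      show "a \<in> V" using a KL(1) maximal_clique_subset by blast
    next
      fix b assume "b \<in> L" "b \<noteq> a"
      then show "adj E a b"
        using simplicial[of "h K" a b] cl[OF KL(1) a] cl[OF KL(2), of b] h[OF KL(1)] KL(3) by metis
    qed
  qed
  have "inj_on h {K. maximal_clique V E K}"
  proof (rule inj_onI)
    fix K L assume "K \<in> {K. maximal_clique V E K}" "L \<in> {K. maximal_clique V E K}" "h K = h L"
    then show "K = L" using sub[of K L] sub[of L K] by simp
  qed
  then show ?thesis unfolding num_max_cliques_def
    using card_inj_on_le[of h "{K. maximal_clique V E K}" F] h assms(1) by auto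
qed

lemma num_max_cliques_eq:
  assumes "finite V" "finite F"
    and "\<And>Q. Q \<in> F \<Longrightarrow> is_clique V E Q"
    and "\<And>P Q. P \<in> F \<Longrightarrow> Q \<in> F \<Longrightarrow> P \<noteq> Q \<Longrightarrow> \<not> is_clique V E (P \<union> Q)"
    and "\<And>K. maximal_clique V E K \<Longrightarrow> \<exists>Q\<in>F. Q \<subseteq> K"
    and "\<And>Q a b. Q \<in> F \<Longrightarrow> is_clique V E (insert a Q) \<Longrightarrow> is_clique V E (insert b Q)
        \<Longrightarrow> a \<noteq> b \<Longrightarrow> adj E a b"
  shows "num_max_cliques V E = card F"
  using num_max_cliques_ge[of V F E] num_max_cliques_le[of F V E] assms by (meson le_antisym)

text \<open>
  Pairwise nonadjacent vertices lie in different maximal cliques.  One or two maximal cliques thus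
  leave no room for two or three such vertices.
\<close>

lemma num_max_cliques_le_1D:
  assumes "finite V" "num_max_cliques V E \<le> 1" "a \<in> V" "b \<in> V" "a \<noteq> b"
  shows "adj E a b"
proof (rule ccontr)
  assume n: "\<not> adj E a b"
  have "card {{a},{b}} \<le> num_max_cliques V E"
    by (rule num_max_cliques_ge) (use assms n in \<open>auto simp: is_clique_iff adj_sym[of E b a]\<close>)
  then show False using assms by auto
qed

lemma num_max_cliques_le_2D:
  assumes "finite V" "num_max_cliques V E \<le> 2" "{a, b, c} \<subseteq> V" "distinct [a, b, c]"
  shows "adj E a b \<or> adj E a c \<or> adj E b c"
proof (rule ccontr)
  assume n: "\<not> ?thesis"
  have "card {{a},{b},{c}} \<le> num_max_cliques V E"
    by (rule num_max_cliques_ge)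
      (use assms n in \<open>auto simp: is_clique_iff adj_sym[of E b a] adj_sym[of E c a] adj_sym[of E c b]\<close>)
  then show False using assms by (auto simp: card_insert_if)
qed

section \<open>Exact values for split graphs\<close>

lemma K1_like_iff:
  "K1_like V E \<longleftrightarrow> (\<exists>X Y z. V = X \<union> Y \<and> is_clique V E X \<and> is_clique V (- E) Y \<and> z \<in> X \<and> z \<in> Y)"
  unfolding K1_like_def is_anticlique_iff by blast

lemma K1_like_compl: "K1_like V (- E) \<longleftrightarrow> K1_like V E"
  unfolding K1_like_iff by simp (metis Un_commute)

text \<open>
  The maximal cliques are \<open>{y} \<union> (N(y) \<inter> X)\<close> for \<open>y \<in> Y\<close>; the vertex \<open>z\<close> stands for \<open>X\<close> itself.
\<close>

lemma num_max_cliques_K1: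
  assumes "finite V" "V = X \<union> Y" "is_clique V E X" "is_clique V (- E) Y" "z \<in> X" "z \<in> Y"
  shows "num_max_cliques V E = card Y"
proof -
  have Y: "\<And>a b. a \<in> Y \<Longrightarrow> b \<in> Y \<Longrightarrow> a \<noteq> b \<Longrightarrow> \<not> adj E a b"
    and X: "\<And>a b. a \<in> X \<Longrightarrow> b \<in> X \<Longrightarrow> a \<noteq> b \<Longrightarrow> adj E a b"
    using assms by (auto simp: is_clique_iff)
  have "num_max_cliques V E = card ((\<lambda>y. {y}) ` Y)"
  proof (rule num_max_cliques_eq)
    show "finite V" "finite ((\<lambda>y. {y}) ` Y)" using assms by auto
    show "is_clique V E Q" if "Q \<in> (\<lambda>y. {y}) ` Y" for Q
      using that assms by (auto simp: is_clique_iff)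
    show "\<not> is_clique V E (P \<union> Q)" if "P \<in> (\<lambda>y. {y}) ` Y" "Q \<in> (\<lambda>y. {y}) ` Y" "P \<noteq> Q" for P Q
      using that Y by (auto simp: is_clique_iff)
    show "\<exists>Q \<in> (\<lambda>y. {y}) ` Y. Q \<subseteq> K" if K: "maximal_clique V E K" for K
    proof (cases "K \<inter> Y = {}")
      case True
      then have "K \<subseteq> X" using maximal_clique_subset[OF K] assms(2) by auto
      then have "z \<in> K" using maximal_clique_absorb[OF K, of z] X assms by blast
      then show ?thesis using assms by auto
    qed auto
    show "adj E a b" if "Q \<in> (\<lambda>y. {y}) ` Y" "is_clique V E (insert a Q)" "is_clique V E (insert b Q)" "a \<noteq> b"
      for Q a b
    proof -
      from that(1) obtain y where y: "Q = {y}" "y \<in> Y" by auto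
      have "c = y \<or> c \<in> X" if "is_clique V E (insert c Q)" for c
        using that y Y[of c y] assms(2) by (auto simp: is_clique_iff)
      from this[OF that(2)] this[OF that(3)] show ?thesis
        using that X[of a b] y by (auto simp: is_clique_iff)
    qed
  qed
  also have "\<dots> = card Y" by (rule card_image) auto
  finally show ?thesis .
qed

lemma K1_like_value:
  assumes "finite V" "K1_like V E"
  shows "num_max_cliques V E + num_max_cliques V (- E) = card V + 1"
proof -
  obtain X Y z where XY: "V = X \<union> Y" "is_clique V E X" "is_clique V (- E) Y" "z \<in> X" "z \<in> Y"
    using assms(2) by (auto simp: K1_like_iff)
  have "x = z" if "x \<in> X" "x \<in> Y" for x
    using XY that by (fastforce simp: is_clique_iff)
  then have "X \<inter> Y = {z}" using XY(4,5) by blast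
  moreover have "card X + card Y = card (X \<union> Y) + card (X \<inter> Y)"
    by (rule card_Un_Int) (use assms(1) XY(1) in auto)
  ultimately have "card X + card Y = card V + 1" using XY(1) by simp
  moreover have "num_max_cliques V E = card Y" by (rule num_max_cliques_K1) (use assms XY in auto)
  moreover have "num_max_cliques V (- E) = card X"
    by (rule num_max_cliques_K1[where X = Y and z = z]) (use assms XY in auto)
  ultimately show ?thesis by simp
qed

text \<open>
  As in the \<open>K\<^sub>1\<close>-like case, but no vertex of \<open>Y\<close> now accounts for \<open>X\<close>.
\<close>

lemma num_max_cliques_P4:
  assumes "finite V" "V = X \<union> Y" "maximal_clique V E X" "is_clique V (- E) Y" "X \<inter> Y = {}"
  shows "num_max_cliques V E = card Y + 1"
proof -
  let ?F = "insert X ((\<lambda>y. {y}) ` Y)"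
  have Y: "\<And>a b. a \<in> Y \<Longrightarrow> b \<in> Y \<Longrightarrow> a \<noteq> b \<Longrightarrow> \<not> adj E a b"
    and X: "\<And>a b. a \<in> X \<Longrightarrow> b \<in> X \<Longrightarrow> a \<noteq> b \<Longrightarrow> adj E a b"
    using assms by (auto simp: is_clique_iff maximal_clique_def)
  have XQ: "\<not> is_clique V E (insert y X)" if "y \<in> Y" for y
    using maximal_clique_subset_eq[OF assms(3), of "insert y X"] that assms(5) by auto
  have "num_max_cliques V E = card ?F"
  proof (rule num_max_cliques_eq)
    show "finite V" "finite ?F" using assms by auto
    show "is_clique V E Q" if "Q \<in> ?F" for Q
      using that assms by (auto simp: is_clique_iff maximal_clique_def)
    show "\<not> is_clique V E (P \<union> Q)" if "P \<in> ?F" "Q \<in> ?F" "P \<noteq> Q" for P Q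
      using that XQ Y by (auto simp: is_clique_iff)
    show "\<exists>Q \<in> ?F. Q \<subseteq> K" if K: "maximal_clique V E K" for K
    proof (cases "K \<inter> Y = {}")
      case True
      then have "K \<subseteq> X" using maximal_clique_subset[OF K] assms(2) by auto
      then have "X = K" using maximal_clique_subset_eq[OF K] assms(3) maximal_clique_is_clique by blast
      then show ?thesis by auto
    qed auto
    show "adj E a b" if "Q \<in> ?F" "is_clique V E (insert a Q)" "is_clique V E (insert b Q)" "a \<noteq> b"
      for Q a b
    proof (cases "Q = X")
      case True
      have "c \<in> X" if "is_clique V E (insert c X)" for c
      proof -
        have "c \<in> V" using that by (simp add: is_clique_iff)
        then show ?thesis using XQ that assms(2) by blast
      qed
      then have "a \<in> X" "b \<in> X" using that True by auto
      then show ?thesis using X that by blast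
    next
      case False
      with that(1) obtain y where y: "Q = {y}" "y \<in> Y" by auto
      have "c = y \<or> c \<in> X" if "is_clique V E (insert c Q)" for c
        using that y Y[of c y] assms(2) by (auto simp: is_clique_iff)
      from this[OF that(2)] this[OF that(3)] show ?thesis
        using that X[of a b] y by (auto simp: is_clique_iff)
    qed
  qed
  also have "X \<notin> (\<lambda>y. {y}) ` Y" using assms(5) by auto
  then have "card ?F = card Y + 1"
    using assms(1,2) by (simp add: card_image)
  finally show ?thesis .
qed

lemma P4_like_value:
  assumes "finite V" "P4_like V E"
  shows "num_max_cliques V E + num_max_cliques V (- E) = card V + 2"
proof -
  obtain X Y where XY: "V = X \<union> Y" "maximal_clique V E X" "maximal_clique V (- E) Y" "X \<inter> Y = {}"
    using assms(2) by (auto simp: P4_like_def maximal_anticlique_iff)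
  have "card V = card X + card Y" using assms XY by (simp add: card_Un_disjoint)
  moreover have "num_max_cliques V E = card Y + 1"
    by (rule num_max_cliques_P4) (use assms XY maximal_clique_is_clique in auto)
  moreover have "num_max_cliques V (- E) = card X + 1"
    by (rule num_max_cliques_P4[where X = Y]) (use assms XY maximal_clique_is_clique in auto)
  ultimately show ?thesis by simp
qed

section \<open>Exact values for graphs built on a square\<close>

text \<open>
  The witnesses of \<open>C4_like\<close> as parameters: attaching a vertex to such a graph means rearranging them.
\<close>

definition C4_frame ::
  "'a set \<Rightarrow> 'a set set \<Rightarrow> 'a \<Rightarrow> 'a \<Rightarrow> 'a \<Rightarrow> 'a \<Rightarrow> 'a set \<Rightarrow> 'a set \<Rightarrow> bool" where
  "C4_frame V E p q r s X Y \<longleftrightarrow>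
     distinct [p, q, r, s] \<and> {p, q, r, s} \<inter> (X \<union> Y) = {} \<and> V = {p, q, r, s} \<union> X \<union> Y \<and>
     adj E p q \<and> adj E q r \<and> adj E r s \<and> adj E p s \<and> \<not> adj E p r \<and> \<not> adj E q s \<and>
     (\<forall>a\<in>X. \<forall>b\<in>X. a \<noteq> b \<longrightarrow> adj E a b) \<and> (\<forall>a\<in>Y. \<forall>b\<in>Y. a \<noteq> b \<longrightarrow> \<not> adj E a b) \<and>
     (\<forall>x\<in>X. adj E x p \<and> adj E x q \<and> (adj E x r \<or> adj E x s)) \<and>
     (\<forall>y\<in>Y. \<not> adj E y p \<and> \<not> adj E y q \<and> \<not> adj E y r \<and> \<not> adj E y s)"

lemma C4_frameD:
  assumes "C4_frame V E p q r s X Y"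
  shows C4_frame_distinct: "p \<noteq> q" "q \<noteq> r" "p \<noteq> r" "p \<noteq> s" "q \<noteq> s" "r \<noteq> s"
    and C4_frame_notin: "p \<notin> X" "q \<notin> X" "r \<notin> X" "s \<notin> X" "p \<notin> Y" "q \<notin> Y" "r \<notin> Y" "s \<notin> Y"
    and C4_frame_vertices: "V = {p, q, r, s} \<union> X \<union> Y"
    and C4_frame_square: "adj E p q" "adj E q r" "adj E r s" "adj E p s" "\<not> adj E p r" "\<not> adj E q s"
      "adj E q p" "adj E r q" "adj E s r" "adj E s p" "\<not> adj E r p" "\<not> adj E s q"
    and C4_frame_X: "a \<in> X \<Longrightarrow> b \<in> X \<Longrightarrow> a \<noteq> b \<Longrightarrow> adj E a b"
    and C4_frame_Y: "a \<in> Y \<Longrightarrow> b \<in> Y \<Longrightarrow> a \<noteq> b \<Longrightarrow> \<not> adj E a b"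
    and C4_frame_XU: "x \<in> X \<Longrightarrow> adj E x p \<and> adj E x q \<and> (adj E x r \<or> adj E x s)"
      "x \<in> X \<Longrightarrow> adj E p x \<and> adj E q x \<and> (adj E r x \<or> adj E s x)"
    and C4_frame_YU: "y \<in> Y \<Longrightarrow> \<not> adj E y p \<and> \<not> adj E y q \<and> \<not> adj E y r \<and> \<not> adj E y s"
      "y \<in> Y \<Longrightarrow> \<not> adj E p y \<and> \<not> adj E q y \<and> \<not> adj E r y \<and> \<not> adj E s y"
proof -
  show "p \<noteq> q" "q \<noteq> r" "p \<noteq> r" "p \<noteq> s" "q \<noteq> s" "r \<noteq> s"
    "p \<notin> X" "q \<notin> X" "r \<notin> X" "s \<notin> X" "p \<notin> Y" "q \<notin> Y" "r \<notin> Y" "s \<notin> Y"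
    using assms unfolding C4_frame_def by simp_all
  show "V = {p, q, r, s} \<union> X \<union> Y" using assms unfolding C4_frame_def by blast
  show sq: "adj E p q" "adj E q r" "adj E r s" "adj E p s" "\<not> adj E p r" "\<not> adj E q s"
    using assms unfolding C4_frame_def by simp_all
  show "adj E q p" "adj E r q" "adj E s r" "adj E s p" "\<not> adj E r p" "\<not> adj E s q"
    using sq by (metis adj_sym)+
  show "a \<in> X \<Longrightarrow> b \<in> X \<Longrightarrow> a \<noteq> b \<Longrightarrow> adj E a b" "a \<in> Y \<Longrightarrow> b \<in> Y \<Longrightarrow> a \<noteq> b \<Longrightarrow> \<not> adj E a b"
    using assms unfolding C4_frame_def by simp_all
  show XU: "x \<in> X \<Longrightarrow> adj E x p \<and> adj E x q \<and> (adj E x r \<or> adj E x s)"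
    and YU: "y \<in> Y \<Longrightarrow> \<not> adj E y p \<and> \<not> adj E y q \<and> \<not> adj E y r \<and> \<not> adj E y s"
    using assms unfolding C4_frame_def by blast+
  show "x \<in> X \<Longrightarrow> adj E p x \<and> adj E q x \<and> (adj E r x \<or> adj E s x)"
    using XU by (metis adj_sym)
  show "y \<in> Y \<Longrightarrow> \<not> adj E p y \<and> \<not> adj E q y \<and> \<not> adj E r y \<and> \<not> adj E s y"
    using YU by (metis adj_sym)
qed

lemma C4_frameI:
  assumes "p \<noteq> q" "q \<noteq> r" "p \<noteq> r" "p \<noteq> s" "q \<noteq> s" "r \<noteq> s"
    and "{p, q, r, s} \<inter> (X \<union> Y) = {}" and "V = {p, q, r, s} \<union> X \<union> Y"
    and "adj E p q" "adj E q r" "adj E r s" "adj E p s" "\<not> adj E p r" "\<not> adj E q s"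
    and "\<And>a b. a \<in> X \<Longrightarrow> b \<in> X \<Longrightarrow> a \<noteq> b \<Longrightarrow> adj E a b"
    and "\<And>a b. a \<in> Y \<Longrightarrow> b \<in> Y \<Longrightarrow> a \<noteq> b \<Longrightarrow> \<not> adj E a b"
    and "\<And>x. x \<in> X \<Longrightarrow> adj E x p \<and> adj E x q \<and> (adj E x r \<or> adj E x s)"
    and "\<And>y. y \<in> Y \<Longrightarrow> \<not> adj E y p \<and> \<not> adj E y q \<and> \<not> adj E y r \<and> \<not> adj E y s"
  shows "C4_frame V E p q r s X Y"
  unfolding C4_frame_def
proof (intro conjI)
  show "distinct [p, q, r, s]" using assms(1-6) by simp
  show "\<forall>a\<in>X. \<forall>b\<in>X. a \<noteq> b \<longrightarrow> adj E a b" using assms(15) by simp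
  show "\<forall>a\<in>Y. \<forall>b\<in>Y. a \<noteq> b \<longrightarrow> \<not> adj E a b" using assms(16) by simp
  show "\<forall>x\<in>X. adj E x p \<and> adj E x q \<and> (adj E x r \<or> adj E x s)" using assms(17) by simp
  show "\<forall>y\<in>Y. \<not> adj E y p \<and> \<not> adj E y q \<and> \<not> adj E y r \<and> \<not> adj E y s" using assms(18) by simp
qed (fact assms)+

text \<open>
  The reflection of the square that exchanges the two ends of its side \<open>pq\<close>.
\<close>

lemma C4_frame_swap:
  assumes f: "C4_frame V E p q r s X Y"
  shows "C4_frame V E q p s r X Y"
proof (rule C4_frameI)
  note d = C4_frame_distinct[OF f] and sq = C4_frame_square[OF f]
  show "q \<noteq> p" "p \<noteq> s" "q \<noteq> s" "q \<noteq> r" "p \<noteq> r" "s \<noteq> r" using d by auto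
  show "{q, p, s, r} \<inter> (X \<union> Y) = {}" using C4_frame_notin[OF f] by blast
  show "V = {q, p, s, r} \<union> X \<union> Y" using C4_frame_vertices[OF f] by blast
  show "adj E q p" "adj E p s" "adj E s r" "adj E q r" "\<not> adj E q s" "\<not> adj E p r" by (rule sq)+
  show "adj E a b" if "a \<in> X" "b \<in> X" "a \<noteq> b" for a b using C4_frame_X[OF f that] .
  show "\<not> adj E a b" if "a \<in> Y" "b \<in> Y" "a \<noteq> b" for a b using C4_frame_Y[OF f that] .
  show "adj E x q \<and> adj E x p \<and> (adj E x s \<or> adj E x r)" if "x \<in> X" for x
    using C4_frame_XU(1)[OF f that] by blast
  show "\<not> adj E y q \<and> \<not> adj E y p \<and> \<not> adj E y s \<and> \<not> adj E y r" if "y \<in> Y" for y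
    using C4_frame_YU(1)[OF f that] by blast
qed

lemma C4_like_iff: "C4_like V E \<longleftrightarrow> (\<exists>p q r s X Y. C4_frame V E p q r s X Y)"
proof
  assume "C4_like V E"
  then obtain U p q r s where U: "U = {p, q, r, s} \<and> card U = 4 \<and> U \<subseteq> V \<and>
        {p, q} \<in> E \<and> {q, r} \<in> E \<and> {r, s} \<in> E \<and> {p, s} \<in> E \<and>
        {p, r} \<notin> E \<and> {q, s} \<notin> E \<and>
        (\<exists>X Y. V - U = X \<union> Y \<and> is_clique V E X \<and> is_anticlique V E Y \<and>
           (\<forall>x\<in>X. {x, p} \<in> E \<and> {x, q} \<in> E \<and> (\<exists>u\<in>U - {p, q}. {x, u} \<in> E)) \<and>
           (\<forall>y\<in>Y. \<forall>u\<in>U. {y, u} \<notin> E))"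
    unfolding C4_like_def by (elim exE) (rule that)
  then obtain X Y where XY: "V - U = X \<union> Y \<and> is_clique V E X \<and> is_anticlique V E Y \<and>
           (\<forall>x\<in>X. {x, p} \<in> E \<and> {x, q} \<in> E \<and> (\<exists>u\<in>U - {p, q}. {x, u} \<in> E)) \<and>
           (\<forall>y\<in>Y. \<forall>u\<in>U. {y, u} \<notin> E)"
    by (elim conjE exE) (rule that, (intro conjI; assumption))
  have Ueq: "U = {p, q, r, s}" using U by (elim conjE)
  have *: "card {p,q,r,s} = 4" "{p,q,r,s} \<subseteq> V"
      "{p, q} \<in> E" "{q, r} \<in> E" "{r, s} \<in> E" "{p, s} \<in> E" "{p, r} \<notin> E" "{q, s} \<notin> E"
      "V - {p,q,r,s} = X \<union> Y" "is_clique V E X" "is_anticlique V E Y"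
      "\<forall>x\<in>X. {x, p} \<in> E \<and> {x, q} \<in> E \<and> (\<exists>u\<in>{p,q,r,s} - {p, q}. {x, u} \<in> E)"
      "\<forall>y\<in>Y. \<forall>u\<in>{p,q,r,s}. {y, u} \<notin> E"
    using U XY unfolding Ueq by - (elim conjE, assumption)+
  have "C4_frame V E p q r s X Y"
    unfolding C4_frame_def adj_def
  proof (intro conjI)
    show "distinct [p,q,r,s]" using *(1) by (intro card_distinct) simp
    show "{p, q, r, s} \<inter> (X \<union> Y) = {}" "V = {p, q, r, s} \<union> X \<union> Y" using *(2,9) by blast+
    show "\<forall>a\<in>X. \<forall>b\<in>X. a \<noteq> b \<longrightarrow> {a, b} \<in> E" using *(10) by (simp add: is_clique_iff adj_def)
    show "\<forall>a\<in>Y. \<forall>b\<in>Y. a \<noteq> b \<longrightarrow> {a, b} \<notin> E"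
      using *(11) by (simp add: is_anticlique_iff is_clique_iff adj_def)
    show "\<forall>x\<in>X. {x, p} \<in> E \<and> {x, q} \<in> E \<and> ({x, r} \<in> E \<or> {x, s} \<in> E)"
      using *(12) by blast
    show "\<forall>y\<in>Y. {y, p} \<notin> E \<and> {y, q} \<notin> E \<and> {y, r} \<notin> E \<and> {y, s} \<notin> E" using *(13) by blast
  qed (fact *)+
  then show "\<exists>p q r s X Y. C4_frame V E p q r s X Y" by blast
next
  assume "\<exists>p q r s X Y. C4_frame V E p q r s X Y"
  then obtain p q r s X Y where f: "C4_frame V E p q r s X Y" by blast
  let ?U = "{p, q, r, s}"
  note d = C4_frame_distinct[OF f]
  have disj: "?U \<inter> (X \<union> Y) = {}" using C4_frame_notin[OF f] by blast
  note V = disj C4_frame_vertices[OF f]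
  have "card ?U = 4" "?U \<subseteq> V" "V - ?U = X \<union> Y" using d V by (simp, blast, blast)
  moreover have "is_clique V E X" "is_anticlique V E Y"
    using V(2) C4_frame_X[OF f] C4_frame_Y[OF f] unfolding is_clique_iff is_anticlique_iff adj_compl
    by blast+
  moreover have "\<forall>x\<in>X. {x, p} \<in> E \<and> {x, q} \<in> E \<and> (\<exists>u\<in>?U - {p, q}. {x, u} \<in> E)"
    using C4_frame_XU(1)[OF f] d unfolding adj_def by simp
  moreover have "\<forall>y\<in>Y. \<forall>u\<in>?U. {y, u} \<notin> E"
    using C4_frame_YU(1)[OF f] unfolding adj_def by simp
  moreover have "{p, q} \<in> E" "{q, r} \<in> E" "{r, s} \<in> E" "{p, s} \<in> E" "{p, r} \<notin> E" "{q, s} \<notin> E"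
    using C4_frame_square(1-6)[OF f] unfolding adj_def .
  ultimately show "C4_like V E" unfolding C4_like_def
    by (intro exI conjI) (rule refl | assumption)+
qed


lemma C4_frame_cong:
  assumes "\<And>a b. a \<in> V \<Longrightarrow> b \<in> V \<Longrightarrow> a \<noteq> b \<Longrightarrow> adj E a b \<longleftrightarrow> adj E' a b"
    and f: "C4_frame V E p q r s X Y"
  shows "C4_frame V E' p q r s X Y"
proof -
  note d = C4_frame_distinct[OF f] and n = C4_frame_notin[OF f] and V = C4_frame_vertices[OF f]
  have "adj E p q = adj E' p q" "adj E q r = adj E' q r" "adj E r s = adj E' r s"
    "adj E p s = adj E' p s" "adj E p r = adj E' p r" "adj E q s = adj E' q s"
    using d by (intro assms(1); (simp add: V)?)+
  moreover have "adj E x u = adj E' x u" if "x \<in> X \<union> Y" "u \<in> {p, q, r, s}" for x u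
    by (rule assms(1)) (use V n that in blast)+
  moreover have "adj E a b = adj E' a b" if "a \<in> X \<union> Y" "b \<in> X \<union> Y" "a \<noteq> b" for a b
    by (rule assms(1)) (use V that in blast)+
  ultimately show ?thesis using f unfolding C4_frame_def by simp
qed

lemma C4_like_compl_edges: "C4_like V (compl_edges V E) \<longleftrightarrow> C4_like V (- E)"
proof -
  have "adj (compl_edges V E) a b \<longleftrightarrow> adj (- E) a b" if "a \<in> V" "b \<in> V" "a \<noteq> b" for a b
    using that by (auto simp: adj_def compl_edges_def nsets_def)
  then show ?thesis
    unfolding C4_like_iff
    using C4_frame_cong[of V "compl_edges V E" "- E"] C4_frame_cong[of V "- E" "compl_edges V E"]
    by metis
qed

lemma card_C4_frame:
  assumes "finite V" and f: "C4_frame V E p q r s X Y"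
  shows "card V = 4 + card X + card Y"
proof -
  note d = C4_frame_distinct[OF f] and disj = C4_frame_notin[OF f] and V = C4_frame_vertices[OF f]
    and sq = C4_frame_square[OF f] and X = C4_frame_X[OF f] and Y = C4_frame_Y[OF f]
    and XU = C4_frame_XU[OF f] and YU = C4_frame_YU[OF f]
  have XY: "X \<inter> Y = {}" using XU YU by blast
  have fin: "finite X" "finite Y" using assms(1) V by auto
  have "card V = card {p, q, r, s} + card (X \<union> Y)"
    unfolding V Un_assoc by (rule card_Un_disjoint) (use fin disj in auto)
  also have "card {p, q, r, s} = 4" using d by simp
  also have "card (X \<union> Y) = card X + card Y" by (rule card_Un_disjoint) (use fin XY in auto)
  finally show ?thesis by simp
qed

text \<open>
  Every maximal clique that avoids \<open>Y\<close> contains exactly one side of the square: a clique inside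
  \<open>X\<close> can be extended by \<open>p\<close> and \<open>q\<close>, and a single \<open>r\<close> or \<open>s\<close> by its neighbour \<open>q\<close> or \<open>p\<close>.  The
  common neighbours of the ends of a side lie in \<open>X\<close>.
\<close>

lemma num_max_cliques_C4_frame:
  assumes "finite V" and f: "C4_frame V E p q r s X Y"
  shows "num_max_cliques V E = 4 + card Y"
proof -
  note d = C4_frame_distinct[OF f] and disj = C4_frame_notin[OF f] and V = C4_frame_vertices[OF f]
    and sq = C4_frame_square[OF f] and X = C4_frame_X[OF f] and Y = C4_frame_Y[OF f]
    and XU = C4_frame_XU[OF f] and YU = C4_frame_YU[OF f]
  have fin: "finite X" "finite Y" using assms(1) C4_frame_vertices[OF f] by auto
  let ?F = "{{p, q}, {q, r}, {r, s}, {p, s}} \<union> (\<lambda>y. {y}) ` Y"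
  have "num_max_cliques V E = card ?F"
  proof (rule num_max_cliques_eq)
    show "finite V" "finite ?F" using assms(1) fin by auto
    show "is_clique V E Q" if "Q \<in> ?F" for Q
      using that V sq by (auto simp: is_clique_iff)
    show "\<not> is_clique V E (P \<union> Q)" if PF: "P \<in> ?F" and QF: "Q \<in> ?F" and PQ: "P \<noteq> Q" for P Q
    proof -
      have 1: "\<exists>a\<in>Q. \<exists>b\<in>Q'. a \<noteq> b \<and> \<not> adj E a b" if "Q \<in> {{p, q}, {q, r}, {r, s}, {p, s}}"
        "Q' \<in> {{p, q}, {q, r}, {r, s}, {p, s}}" "Q \<noteq> Q'" for Q Q'
        using that sq d by auto
      have 2: "\<exists>a\<in>Q. a \<noteq> y \<and> \<not> adj E y a" if "Q \<in> {{p, q}, {q, r}, {r, s}, {p, s}}" "y \<in> Y" for Q y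
        using that YU[OF that(2)] disj by auto
      show ?thesis
      proof (cases "P \<in> (\<lambda>y. {y}) ` Y")
        case P: True
        then obtain y where y: "P = {y}" "y \<in> Y" by auto
        show ?thesis
        proof (cases "Q \<in> (\<lambda>y. {y}) ` Y")
          case True
          then show ?thesis using y Y PQ by (auto simp: is_clique_iff)
        next
          case False
          then have "Q \<in> {{p, q}, {q, r}, {r, s}, {p, s}}" using QF by blast
          then obtain a where "a \<in> Q" "a \<noteq> y" "\<not> adj E y a" using 2[of Q y] y(2) by blast
          then show ?thesis using y by (auto simp: is_clique_iff)
        qed
      next
        case P: False
        then have P: "P \<in> {{p, q}, {q, r}, {r, s}, {p, s}}" using PF by blast
        show ?thesis
        proof (cases "Q \<in> (\<lambda>y. {y}) ` Y")
          case True
          then obtain y where y: "Q = {y}" "y \<in> Y" by auto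
          then obtain a where "a \<in> P" "a \<noteq> y" "\<not> adj E y a" using 2[of P y] P by blast
          then show ?thesis using y adj_sym[of E y a] by (auto simp: is_clique_iff)
        next
          case False
          then have "Q \<in> {{p, q}, {q, r}, {r, s}, {p, s}}" using QF by blast
          then obtain a b where "a \<in> P" "b \<in> Q" "a \<noteq> b" "\<not> adj E a b"
            using 1[of P Q] P PQ by blast
          then show ?thesis by (auto simp: is_clique_iff)
        qed
      qed
    qed
    show "\<exists>Q\<in>?F. Q \<subseteq> K" if K: "maximal_clique V E K" for K
    proof (cases "K \<inter> Y = {}")
      case True
      then have KV: "K \<subseteq> {p, q, r, s} \<union> X" using maximal_clique_subset[OF K] V by auto
      have ab: "v \<in> K" if "v \<in> V" "\<And>x. x \<in> {p, q, r, s} \<inter> K \<union> X \<Longrightarrow> x \<noteq> v \<Longrightarrow> adj E v x" for v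
        by (rule maximal_clique_absorb[OF K]) (use that KV in blast)+
      have "{p, q} \<subseteq> K \<or> {q, r} \<subseteq> K \<or> {r, s} \<subseteq> K \<or> {p, s} \<subseteq> K"
      proof (cases "r \<in> K \<or> s \<in> K")
        case rs: True
        have "p \<notin> K" if "r \<in> K" using that maximal_cliqueD[OF K, of p r] sq d by blast
        moreover have "q \<notin> K" if "s \<in> K" using that maximal_cliqueD[OF K, of q s] sq d by blast
        moreover have "q \<in> K" if "s \<notin> K"
          by (rule ab) (use that V XU sq in auto)
        moreover have "p \<in> K" if "r \<notin> K"
          by (rule ab) (use that V XU sq in auto)
        ultimately show ?thesis using rs by auto
      next
        case rs: False
        have "p \<in> K" by (rule ab) (use rs V XU sq in auto)
        moreover have "q \<in> K" by (rule ab) (use rs V XU sq in auto)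
        ultimately show ?thesis by auto
      qed
      then show ?thesis by auto
    qed auto
    show "adj E a b" if Q: "Q \<in> ?F" and a: "is_clique V E (insert a Q)"
      and b: "is_clique V E (insert b Q)" and "a \<noteq> b"
      for Q a b
    proof (cases "Q \<in> (\<lambda>y. {y}) ` Y")
      case True
      then obtain y where y: "Q = {y}" "y \<in> Y" by auto
      have "c = y \<or> c \<in> X" if "is_clique V E (insert c Q)" for c
        using that y Y[of c y] V XU YU by (auto simp: is_clique_iff)
      from this[OF a] this[OF b] show ?thesis
        using a b y X[of a b] \<open>a \<noteq> b\<close> by (auto simp: is_clique_iff)
    next
      case False
      have "c \<in> X \<union> Q" if c: "is_clique V E (insert c Q)" for c
      proof -
        have "c \<in> V" and "\<And>x. x \<in> Q \<Longrightarrow> c = x \<or> adj E c x" using c by (auto simp: is_clique_iff)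
        moreover have "Q \<in> {{p, q}, {q, r}, {r, s}, {p, s}}" using False Q by blast
        ultimately show ?thesis using V sq YU by auto
      qed
      from this[OF a] this[OF b] show ?thesis
        using a b X[of a b] \<open>a \<noteq> b\<close> unfolding is_clique_iff by blast
    qed
  qed
  also have "card ?F = card {{p, q}, {q, r}, {r, s}, {p, s}} + card ((\<lambda>y. {y}) ` Y)"
    by (rule card_Un_disjoint) (use fin d in auto)
  also have "card {{p, q}, {q, r}, {r, s}, {p, s}} = 4"
    using d by (simp add: doubleton_eq_iff)
  also have "card ((\<lambda>y. {y}) ` Y) = card Y" by (rule card_image) simp
  finally show ?thesis .
qed

text \<open>
  A vertex of \<open>X\<close> is nonadjacent to at most one vertex of the square, hence lies in a single maximal
  anticlique.  The maximal anticliques that avoid \<open>X\<close> are \<open>Y\<close> with one of the two diagonals.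
\<close>

lemma num_max_anticliques_C4_frame:
  assumes "finite V" and f: "C4_frame V E p q r s X Y"
  shows "num_max_cliques V (- E) = 2 + card X"
proof -
  note d = C4_frame_distinct[OF f] and disj = C4_frame_notin[OF f] and V = C4_frame_vertices[OF f]
    and sq = C4_frame_square[OF f] and X = C4_frame_X[OF f] and Y = C4_frame_Y[OF f]
    and XU = C4_frame_XU[OF f] and YU = C4_frame_YU[OF f]
  have fin: "finite X" "finite Y" using assms(1) C4_frame_vertices[OF f] by auto
  let ?G = "{{p, r}, {q, s}} \<union> (\<lambda>x. {x}) ` X"
  have "num_max_cliques V (- E) = card ?G"
  proof (rule num_max_cliques_eq)
    show "finite V" "finite ?G" using assms(1) fin by auto
    show "is_clique V (- E) Q" if "Q \<in> ?G" for Q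
      using that V sq by (auto simp: is_clique_iff)
    show "\<not> is_clique V (- E) (P \<union> Q)" if "P \<in> ?G" "Q \<in> ?G" "P \<noteq> Q" for P Q
    proof -
      have "\<exists>a\<in>P. \<exists>b\<in>Q. a \<noteq> b \<and> adj E a b"
        using that sq d X XU disj by auto
      then show ?thesis by (auto simp: is_clique_iff)
    qed
    show "\<exists>Q\<in>?G. Q \<subseteq> K" if K: "maximal_clique V (- E) K" for K
    proof (cases "K \<inter> X = {}")
      case True
      then have KV: "K \<subseteq> {p, q, r, s} \<union> Y" using maximal_clique_subset[OF K] V by auto
      have ab: "v \<in> K" if "v \<in> V" "\<And>x. x \<in> {p, q, r, s} \<inter> K \<union> Y \<Longrightarrow> x \<noteq> v \<Longrightarrow> \<not> adj E v x" for v
        by (rule maximal_clique_absorb[OF K]) (use that KV in auto)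
      show ?thesis
      proof (cases "q \<in> K \<or> s \<in> K")
        case qs: True
        then have "p \<notin> K" "r \<notin> K"
          using maximal_cliqueD[OF K, of q p] maximal_cliqueD[OF K, of s p]
            maximal_cliqueD[OF K, of q r] maximal_cliqueD[OF K, of s r] sq d by auto
        then have "q \<in> K \<and> s \<in> K"
          by (intro conjI; intro ab) (use V YU sq in auto)
        then show ?thesis by auto
      next
        case qs: False
        then have "p \<in> K \<and> r \<in> K"
          by (intro conjI; intro ab) (use V YU sq in auto)
        then show ?thesis by auto
      qed
    qed auto
    show "adj (- E) a b" if Q: "Q \<in> ?G" and a: "is_clique V (- E) (insert a Q)"
      and b: "is_clique V (- E) (insert b Q)" and "a \<noteq> b"
      for Q a b
    proof (cases "Q \<in> (\<lambda>x. {x}) ` X")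
      case True
      then obtain x where x: "Q = {x}" "x \<in> X" by auto
      have 1: "c = x \<or> \<not> adj E c x \<and> \<not> adj E x c \<and> (c \<in> Y \<or> c = r \<or> c = s)" if "is_clique V (- E) (insert c Q)" for c
        using that x X[of c x] V XU YU by (auto simp: is_clique_iff)
      show ?thesis
        using 1[OF a] 1[OF b] a b x \<open>a \<noteq> b\<close> Y[of a b] YU XU[of x] by (auto simp: is_clique_iff)
    next
      case False
      have "c \<in> Y \<union> Q" if c: "is_clique V (- E) (insert c Q)" for c
      proof -
        have "c \<in> V" and "\<And>x. x \<in> Q \<Longrightarrow> c = x \<or> \<not> adj E c x" using c by (auto simp: is_clique_iff)
        moreover have "Q = {p, r} \<or> Q = {q, s}" using False Q by blast
        ultimately show ?thesis using V sq XU by auto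
      qed
      from this[OF a] this[OF b] show ?thesis
        using a b Y[of a b] \<open>a \<noteq> b\<close> unfolding is_clique_iff adj_compl by blast
    qed
  qed
  also have "card ?G = card {{p, r}, {q, s}} + card ((\<lambda>x. {x}) ` X)"
    by (rule card_Un_disjoint) (use fin d in auto)
  also have "card {{p, r}, {q, s}} = 2"
    using d by (simp add: doubleton_eq_iff)
  also have "card ((\<lambda>x. {x}) ` X) = card X" by (rule card_image) simp
  finally show ?thesis .
qed

lemma C4_like_value:
  assumes "finite V" "C4_like V E"
  shows "num_max_cliques V E + num_max_cliques V (- E) = card V + 2"
proof -
  obtain p q r s X Y where f: "C4_frame V E p q r s X Y" using assms(2) unfolding C4_like_iff by blast
  show ?thesis
    using card_C4_frame[OF assms(1) f] num_max_cliques_C4_frame[OF assms(1) f]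
      num_max_anticliques_C4_frame[OF assms(1) f] by linarith
qed

section \<open>Splitting at a vertex\<close>

definition nbrs :: "'a set \<Rightarrow> 'a set set \<Rightarrow> 'a \<Rightarrow> 'a set" where
  "nbrs V E v = {x \<in> V. x \<noteq> v \<and> adj E v x}"

lemma finite_nbrs: "finite V \<Longrightarrow> finite (nbrs V E v)"
  by (simp add: nbrs_def)

lemma card_nbrs:
  assumes "finite V" "v \<in> V"
  shows "card V = card (nbrs V E v) + card (nbrs V (- E) v) + 1"
proof -
  have "V = insert v (nbrs V E v \<union> nbrs V (- E) v)" using assms(2) by (auto simp: nbrs_def)
  moreover have "v \<notin> nbrs V E v \<union> nbrs V (- E) v" by (auto simp: nbrs_def)
  ultimately have "card V = card (nbrs V E v \<union> nbrs V (- E) v) + 1"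
    using assms(1) by (metis Suc_eq_plus1 card_insert_disjoint finite_insert)
  moreover have "card (nbrs V E v \<union> nbrs V (- E) v) = card (nbrs V E v) + card (nbrs V (- E) v)"
    by (rule card_Un_disjoint) (auto simp: nbrs_def assms(1))
  ultimately show ?thesis by simp
qed

lemma maximal_clique_insert_nbrs:
  assumes "v \<in> V" "maximal_clique (nbrs V E v) E K"
  shows "maximal_clique V E (insert v K)"
  unfolding maximal_clique_iff
proof
  have K: "K \<subseteq> nbrs V E v" using assms(2) by (rule maximal_clique_subset)
  have "adj E v x" "adj E x v" "x \<in> V" if "x \<in> K" for x
    using K that adj_sym[of E v x] by (auto simp: nbrs_def)
  then show "is_clique V E (insert v K)"
    using maximal_cliqueD[OF assms(2)] assms(1) by (auto simp: is_clique_iff)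
  show "\<forall>w\<in>V - insert v K. \<exists>x\<in>insert v K. \<not> adj E w x"
  proof
    fix w assume w: "w \<in> V - insert v K"
    show "\<exists>x\<in>insert v K. \<not> adj E w x"
    proof (cases "w \<in> nbrs V E v")
      case True
      then show ?thesis using assms(2) w unfolding maximal_clique_iff by blast
    next
      case False
      then have "\<not> adj E w v" using w adj_sym[of E v w] by (auto simp: nbrs_def)
      then show ?thesis by blast
    qed
  qed
qed

lemma num_max_cliques_nbrs_le:
  assumes "finite V" "v \<in> V"
  shows "num_max_cliques (nbrs V E v) E \<le> card {K. maximal_clique V E K \<and> v \<in> K}"
  unfolding num_max_cliques_def
proof (rule card_inj_on_le)
  show "inj_on (insert v) {K. maximal_clique (nbrs V E v) E K}"
  proof (rule inj_onI)
    fix K L assume "K \<in> {K. maximal_clique (nbrs V E v) E K}" "L \<in> {K. maximal_clique (nbrs V E v) E K}"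
    then have "v \<notin> K" "v \<notin> L" by (auto dest: maximal_clique_subset simp: nbrs_def)
    then show "insert v K = insert v L \<Longrightarrow> K = L" by (simp add: insert_ident)
  qed
  show "insert v ` {K. maximal_clique (nbrs V E v) E K} \<subseteq> {K. maximal_clique V E K \<and> v \<in> K}"
    using maximal_clique_insert_nbrs[OF assms(2)] by blast
  show "finite {K. maximal_clique V E K \<and> v \<in> K}"
    by (rule finite_subset[OF _ finite_maximal_cliques[OF assms(1), of E]]) blast
qed

text \<open>
  The third summand counts the maximal cliques that are neither of the form \<open>insert v K\<close> nor extensions
  of a maximal clique of \<open>M\<close>; it is what makes the case of equality usable.
\<close>

lemma num_max_cliques_vertex_split:
  fixes V E v
  defines "M \<equiv> nbrs V (- E) v"
  assumes "finite V" "v \<in> V" "M \<noteq> {}"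
  shows "num_max_cliques (nbrs V E v) E + num_max_cliques M E
       + card {K. maximal_clique V E K \<and> v \<notin> K \<and> \<not> maximal_clique M E (K \<inter> M)}
     \<le> num_max_cliques V E"
proof -
  let ?A = "{K. maximal_clique V E K \<and> v \<in> K}"
  let ?B = "{K. maximal_clique V E K \<and> v \<notin> K \<and> maximal_clique M E (K \<inter> M)}"
  let ?C = "{K. maximal_clique V E K \<and> v \<notin> K \<and> \<not> maximal_clique M E (K \<inter> M)}"
  have fin: "finite ?A" "finite ?B" "finite ?C"
    by (rule finite_subset[OF _ finite_maximal_cliques[OF assms(2), of E]]; blast)+
  have "{L. maximal_clique M E L} \<subseteq> (\<lambda>K. K \<inter> M) ` ?B"
  proof
    fix L assume "L \<in> {L. maximal_clique M E L}"
    then have L: "maximal_clique M E L" by simp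
    have "is_clique V E L" using L unfolding maximal_clique_def is_clique_iff M_def nbrs_def by blast
    then obtain K where K: "maximal_clique V E K" "L \<subseteq> K"
      using maximal_clique_extends[OF assms(2)] by blast
    have "is_clique M E (K \<inter> M)" using maximal_cliqueD[OF K(1)] by (auto simp: is_clique_iff)
    then have eq: "K \<inter> M = L"
      using maximal_clique_subset_eq[OF L, of "K \<inter> M"] K(2) maximal_clique_subset[OF L] by blast
    obtain m where m: "m \<in> M" using assms(4) by blast
    have "L \<noteq> {}"
    proof
      assume "L = {}"
      then show False using maximal_clique_absorb[OF L m] by simp
    qed
    then obtain l where l: "l \<in> K" "l \<in> M" using eq by blast
    then have "v \<notin> K" using maximal_cliqueD[OF K(1), of v l] by (auto simp: M_def nbrs_def)
    then show "L \<in> (\<lambda>K. K \<inter> M) ` ?B" using K(1) eq L by blast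
  qed
  then have "num_max_cliques M E \<le> card ?B"
    unfolding num_max_cliques_def by (rule surj_card_le[OF fin(2)])
  moreover have "num_max_cliques (nbrs V E v) E \<le> card ?A"
    by (rule num_max_cliques_nbrs_le[OF assms(2,3)])
  moreover have "card ?A + card ?B + card ?C = card (?A \<union> ?B \<union> ?C)"
  proof -
    have "card (?A \<union> ?B) = card ?A + card ?B" by (rule card_Un_disjoint) (use fin in blast)+
    moreover have "card (?A \<union> ?B \<union> ?C) = card (?A \<union> ?B) + card ?C"
      by (rule card_Un_disjoint) (use fin in blast)+
    ultimately show ?thesis by simp
  qed
  moreover have "card (?A \<union> ?B \<union> ?C) \<le> num_max_cliques V E"
    unfolding num_max_cliques_def by (rule card_mono[OF finite_maximal_cliques[OF assms(2)]]) blast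
  ultimately show ?thesis by linarith
qed

section \<open>Deleting a vertex\<close>

definition dominated :: "'a set \<Rightarrow> 'a set set \<Rightarrow> 'a \<Rightarrow> 'a \<Rightarrow> bool" where
  "dominated V E u w \<longleftrightarrow> u \<in> V \<and> w \<in> V \<and> u \<noteq> w \<and> \<not> adj E u w \<and> nbrs V E u \<subseteq> nbrs V E w"

text \<open>
  Exactly the maximal cliques through \<open>u\<close> that are not obtained by extending a maximal clique of
  \<open>V - {u}\<close>.
\<close>

definition lost_cliques :: "'a set \<Rightarrow> 'a set set \<Rightarrow> 'a \<Rightarrow> 'a set set" where
  "lost_cliques V E u = {K. maximal_clique V E K \<and> u \<in> K \<and> \<not> maximal_clique (V - {u}) E (K - {u})}"

lemma finite_lost_cliques: "finite V \<Longrightarrow> finite (lost_cliques V E u)"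
  unfolding lost_cliques_def by (rule finite_subset[OF _ finite_maximal_cliques[of V E]]) blast

text \<open>
  Every maximal clique of \<open>V - {u}\<close> extends to one of \<open>V\<close> by adding \<open>u\<close> or nothing, and the clique
  can be recovered by removing \<open>u\<close>.
\<close>

lemma num_max_cliques_delete:
  assumes "finite V" "u \<in> V"
  shows "num_max_cliques (V - {u}) E + card (lost_cliques V E u) \<le> num_max_cliques V E"
proof -
  let ?M = "{K. maximal_clique (V - {u}) E K}"
  define h where "h K = (if is_clique V E (insert u K) then insert u K else K)" for K
  have uK: "u \<notin> K" if "K \<in> ?M" for K using that by (auto dest: maximal_clique_subset)
  have h_inverse: "h K - {u} = K" if "K \<in> ?M" for K using uK[OF that] by (auto simp: h_def)
  have inj: "inj_on h ?M" by (rule inj_onI) (metis h_inverse)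
  have max: "maximal_clique V E (h K)" if K: "K \<in> ?M" for K
  proof -
    have KV: "is_clique V E K" using K unfolding maximal_clique_def is_clique_iff by blast
    have out: "\<exists>x\<in>K. \<not> adj E w x" if "w \<in> V - K" "w \<noteq> u" for w
      using K that unfolding maximal_clique_iff by blast
    show ?thesis
    proof (cases "is_clique V E (insert u K)")
      case True
      then show ?thesis using out unfolding maximal_clique_iff by (auto simp: h_def)
    next
      case False
      then have "\<exists>x\<in>K. \<not> adj E u x"
        using KV assms(2) adj_sym[of E u] unfolding is_clique_iff by blast
      then show ?thesis using out KV False unfolding maximal_clique_iff by (auto simp: h_def)
    qed
  qed
  have "h ` ?M \<subseteq> {K. maximal_clique V E K} - lost_cliques V E u"
    using max h_inverse by (auto simp: lost_cliques_def)
  then have "card (h ` ?M) \<le> card ({K. maximal_clique V E K} - lost_cliques V E u)"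
    by (rule card_mono[rotated]) (simp add: finite_maximal_cliques[OF assms(1)])
  also have "\<dots> = num_max_cliques V E - card (lost_cliques V E u)"
    unfolding num_max_cliques_def
    by (rule card_Diff_subset) (auto simp: finite_lost_cliques[OF assms(1)], simp add: lost_cliques_def)
  finally have "num_max_cliques (V - {u}) E \<le> num_max_cliques V E - card (lost_cliques V E u)"
    unfolding num_max_cliques_def card_image[OF inj] .
  moreover have "card (lost_cliques V E u) \<le> num_max_cliques V E"
    unfolding num_max_cliques_def
    by (rule card_mono[OF finite_maximal_cliques[OF assms(1)]]) (auto simp: lost_cliques_def)
  ultimately show ?thesis by linarith
qed

text \<open>
  A maximal clique \<open>K\<close> of \<open>V - {u}\<close> cannot be extended by \<open>u\<close>: otherwise \<open>w\<close> is also adjacent to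
  all of \<open>K\<close>, hence lies in \<open>K\<close>, although \<open>u\<close> and \<open>w\<close> are nonadjacent.  So the maximal cliques of
  \<open>V\<close> through \<open>u\<close>, as many as \<open>N(u)\<close> has, come on top.
\<close>

lemma num_max_cliques_delete_dominated:
  assumes "finite V" and dom: "dominated V E u w"
  shows "num_max_cliques (V - {u}) E + num_max_cliques (nbrs V E u) E \<le> num_max_cliques V E"
proof -
  have u: "u \<in> V" "w \<in> V" "u \<noteq> w" "\<not> adj E u w" "nbrs V E u \<subseteq> nbrs V E w"
    using dom by (auto simp: dominated_def)
  let ?A = "{K. maximal_clique V E K \<and> u \<in> K}"
  have "{K. maximal_clique (V - {u}) E K} \<subseteq> {K. maximal_clique V E K} - ?A"
  proof
    fix K assume "K \<in> {K. maximal_clique (V - {u}) E K}"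
    then have K: "maximal_clique (V - {u}) E K" by simp
    have uK: "u \<notin> K" using maximal_clique_subset[OF K] by blast
    have "\<exists>x\<in>K. \<not> adj E u x"
    proof (rule ccontr)
      assume "\<not> ?thesis"
      then have all: "\<And>x. x \<in> K \<Longrightarrow> adj E u x" by blast
      have "adj E w x" if "x \<in> K" for x
      proof -
        have "x \<in> nbrs V E u" using all[OF that] that maximal_clique_subset[OF K] by (auto simp: nbrs_def)
        then show ?thesis using u(5) by (auto simp: nbrs_def)
      qed
      then have "w \<in> K" using maximal_clique_absorb[OF K, of w] u by blast
      then show False using all u(4) by blast
    qed
    then have "maximal_clique V E K" using K uK unfolding maximal_clique_iff is_clique_iff by blast
    then show "K \<in> {K. maximal_clique V E K} - ?A" using uK by blast
  qed
  then have "num_max_cliques (V - {u}) E \<le> card ({K. maximal_clique V E K} - ?A)"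
    unfolding num_max_cliques_def by (rule card_mono[rotated]) (simp add: finite_maximal_cliques[OF assms(1)])
  also have "\<dots> = num_max_cliques V E - card ?A"
    unfolding num_max_cliques_def
    by (rule card_Diff_subset) (auto intro: finite_subset[OF _ finite_maximal_cliques[OF assms(1), of E]])
  finally have "num_max_cliques (V - {u}) E \<le> num_max_cliques V E - card ?A" .
  moreover have "card ?A \<le> num_max_cliques V E"
    unfolding num_max_cliques_def by (rule card_mono[OF finite_maximal_cliques[OF assms(1)]]) auto
  moreover have "num_max_cliques (nbrs V E u) E \<le> card ?A"
    by (rule num_max_cliques_nbrs_le[OF assms(1) u(1)])
  ultimately show ?thesis by linarith
qed

text \<open>
  If no vertex adjacent to \<open>u'\<close> can be added to \<open>B\<close>, then in every maximal anticlique \<open>A\<close>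
  containing \<open>B\<close> the vertex \<open>u'\<close> can take the place of \<open>u\<close>, so \<open>A - {u}\<close> is not maximal.
\<close>

lemma lost_clique_if_no_blocker:
  assumes "finite V" "is_clique V (- E) B" "u \<in> B" "u' \<in> nbrs V E u"
    and nb: "\<And>a. a \<in> V \<Longrightarrow> a \<noteq> u \<Longrightarrow> a \<noteq> u' \<Longrightarrow> adj E a u' \<Longrightarrow>
        (\<And>b. b \<in> B \<Longrightarrow> b \<noteq> a \<Longrightarrow> \<not> adj E a b) \<Longrightarrow> False"
  shows "\<exists>A \<in> lost_cliques V (- E) u. B \<subseteq> A"
proof -
  obtain A where A: "maximal_clique V (- E) A" "B \<subseteq> A"
    using maximal_clique_extends[OF assms(1,2)] by blast
  have nadj: "\<And>a b. a \<in> A \<Longrightarrow> b \<in> A \<Longrightarrow> a \<noteq> b \<Longrightarrow> \<not> adj E a b"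
    using maximal_cliqueD[OF A(1)] by simp
  have uA: "u \<in> A" using A(2) assms(3) by blast
  have u': "u' \<in> V" "u' \<noteq> u" "adj E u u'" using assms(4) by (auto simp: nbrs_def)
  then have u'A: "u' \<notin> A" using nadj[OF uA] by blast
  have "\<not> maximal_clique (V - {u}) (- E) (A - {u})"
  proof
    assume m: "maximal_clique (V - {u}) (- E) (A - {u})"
    have "u' \<in> A - {u}"
    proof (rule maximal_clique_absorb[OF m])
      show "u' \<in> V - {u}" using u' by blast
    next
      fix a assume a: "a \<in> A - {u}" "a \<noteq> u'"
      have "\<not> adj E a u'"
      proof
        assume "adj E a u'"
        moreover have "a \<in> V" using a(1) maximal_clique_subset[OF A(1)] by blast
        ultimately show False
          using nb[of a] a nadj[of a] A(2) by blast
      qed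
      then show "adj (- E) u' a" using adj_sym[of E a u'] by simp
    qed
    then show False using u'A by blast
  qed
  then show ?thesis using A uA unfolding lost_cliques_def by blast
qed

lemma blocker_exists:
  assumes "finite V" "lost_cliques V (- E) u = {}" "u' \<in> nbrs V E u" "u \<in> B" "B \<subseteq> V"
    "\<And>a b. a \<in> B \<Longrightarrow> b \<in> B \<Longrightarrow> a \<noteq> b \<Longrightarrow> \<not> adj E a b"
  shows "\<exists>a. a \<in> V \<and> a \<noteq> u \<and> a \<noteq> u' \<and> adj E a u' \<and> (\<forall>b\<in>B. a = b \<or> \<not> adj E a b)"
proof (rule ccontr)
  assume n: "\<not> ?thesis"
  have "\<exists>A \<in> lost_cliques V (- E) u. B \<subseteq> A"
    by (rule lost_clique_if_no_blocker[OF assms(1) _ assms(4,3)]) (use assms(5,6) n in \<open>auto simp: is_clique_iff\<close>)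
  then show False using assms(2) by blast
qed

section \<open>Excess at most one forces domination\<close>

text \<open>
  If \<open>v\<close> has both neighbours and non-neighbours, the split at \<open>v\<close> adds up the bounds for the two parts.
  Otherwise \<open>v\<close> is dominated by any other vertex, in the graph or in its complement, and its deletion
  costs at least one maximal clique or anticlique.
\<close>

lemma maximal_clique_sum_ge:
  assumes "finite V" "V \<noteq> {}"
  shows "card V + 1 \<le> num_max_cliques V E + num_max_cliques V (- E)"
  using assms
proof (induction "card V" arbitrary: V rule: less_induct)
  case less
  show ?case
  proof (cases "card V = 1")
    case True
    then show ?thesis
      using num_max_cliques_pos[OF less(2), of E] num_max_cliques_pos[OF less(2), of "- E"] by simp
  next
    case False
    obtain v where v: "v \<in> V" using less(3) by blast
    have "V - {v} \<noteq> {}"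
    proof
      assume "V - {v} = {}"
      then have "V = {v}" using v by blast
      then show False using False by simp
    qed
    then obtain w where w: "w \<in> V" "w \<noteq> v" by blast
    have cV: "card V = card (V - {v}) + 1" using less(2) v
      by (metis Suc_eq_plus1 card_Suc_Diff1)
    have IHv: "card (V - {v}) + 1 \<le> num_max_cliques (V - {v}) E + num_max_cliques (V - {v}) (- E)"
      by (rule less(1)) (use cV less(2) \<open>V - {v} \<noteq> {}\<close> in auto)
    have isolated: "card V + 1 \<le> num_max_cliques V F + num_max_cliques V (- F)"
      if "nbrs V F v = {}" "card (V - {v}) + 1 \<le> num_max_cliques (V - {v}) F + num_max_cliques (V - {v}) (- F)" for F
    proof -
      have "dominated V F v w" using that(1) v w by (auto simp: dominated_def nbrs_def)
      from num_max_cliques_delete_dominated[OF less(2) this] num_max_cliques_delete[OF less(2) v, of "- F"]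
        num_max_cliques_pos[OF finite_nbrs[OF less(2)], of F v F] that(2) cV
      show ?thesis by linarith
    qed
    consider "nbrs V E v = {}" | "nbrs V (- E) v = {}" | "nbrs V E v \<noteq> {}" "nbrs V (- E) v \<noteq> {}" by blast
    then show ?thesis
    proof cases
      case 1 then show ?thesis using isolated[of E] IHv by simp
    next
      case 2 then show ?thesis using isolated[of "- E"] IHv by simp
    next
      case 3
      have IH: "card (nbrs V F v) + 1 \<le> num_max_cliques (nbrs V F v) E + num_max_cliques (nbrs V F v) (- E)"
        if "nbrs V F v \<noteq> {}" for F
      proof (rule less(1))
        show "card (nbrs V F v) < card V"
          by (rule psubset_card_mono[OF less(2)]) (use v in \<open>auto simp: nbrs_def\<close>)
      qed (use that finite_nbrs[OF less(2)] in auto)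
      show ?thesis
        using num_max_cliques_vertex_split[OF less(2) v 3(2)]
          num_max_cliques_vertex_split[OF less(2) v, of "- E"] 3(1)
          IH[OF 3(1)] IH[OF 3(2)] card_nbrs[OF less(2) v, of E] by simp
    qed
  qed
qed

text \<open>
  Let \<open>N(v) = X \<union> Y\<close> with a clique \<open>X\<close> and an anticlique \<open>Y\<close> that share \<open>z\<close>.  If \<open>Y = {z}\<close>, then
  \<open>N(v)\<close> is a clique and \<open>z\<close> is adjacent to all of it.  Otherwise \<open>z\<close> dominates every other
  \<open>y \<in> Y\<close>: the only maximal anticlique of \<open>N(v)\<close> through \<open>z\<close> is \<open>Y\<close>, and by the last assumption
  every maximal anticlique through \<open>z\<close> contains it, so no vertex can be adjacent to \<open>y\<close> but not to
  \<open>z\<close>.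
\<close>

lemma dominated_if_nbrs_K1_like:
  fixes V E v
  defines "N \<equiv> nbrs V E v"
  assumes fin: "finite V" and v: "v \<in> V" and K1: "K1_like N E"
    and tight: "\<And>A. maximal_clique V (- E) A \<Longrightarrow> v \<notin> A \<Longrightarrow> maximal_clique N (- E) (A \<inter> N)"
  shows "(\<exists>u w. dominated V E u w) \<or> (\<exists>u w. dominated V (- E) u w)"
proof -
  obtain X Y z where XY: "N = X \<union> Y" "is_clique N E X" "is_clique N (- E) Y" "z \<in> X" "z \<in> Y"
    using K1 by (auto simp: K1_like_iff)
  have X: "\<And>a b. a \<in> X \<Longrightarrow> b \<in> X \<Longrightarrow> a \<noteq> b \<Longrightarrow> adj E a b"
    and Y: "\<And>a b. a \<in> Y \<Longrightarrow> b \<in> Y \<Longrightarrow> a \<noteq> b \<Longrightarrow> \<not> adj E a b"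
    using XY(2,3) by (auto simp: is_clique_iff)
  have N: "x \<in> N \<longleftrightarrow> x \<in> V \<and> x \<noteq> v \<and> adj E v x" for x by (auto simp: N_def nbrs_def)
  have z: "z \<in> V" "z \<noteq> v" "adj E v z" "adj E z v" using XY(1,4) N[of z] adj_sym[of E v z] by auto
  show ?thesis
  proof (cases "Y = {z}")
    case True
    have "dominated V (- E) z v"
      unfolding dominated_def
    proof (intro conjI subsetI)
      fix x assume "x \<in> nbrs V (- E) z"
      then have x: "x \<in> V" "x \<noteq> z" "\<not> adj E z x" by (auto simp: nbrs_def)
      have "x \<notin> N" using XY(1,4) True X[of z x] x by blast
      then show "x \<in> nbrs V (- E) v" using x z N[of x] by (auto simp: nbrs_def)
    qed (use z v in auto)
    then show ?thesis by blast
  next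
    case False
    then obtain y where y: "y \<in> Y" "y \<noteq> z" using XY(5) by blast
    have yN: "y \<in> V" "y \<noteq> v" "adj E v y" using y(1) XY(1) N[of y] by auto
    have "dominated V E y z"
      unfolding dominated_def
    proof (intro conjI subsetI)
      fix x assume "x \<in> nbrs V E y"
      then have x: "x \<in> V" "x \<noteq> y" "adj E y x" by (auto simp: nbrs_def)
      have xz: "x \<noteq> z" using Y[OF y(1) XY(5) y(2)] x(3) by blast
      have "adj E z x"
      proof (rule ccontr)
        assume n: "\<not> adj E z x"
        have "x \<notin> Y" using Y[OF y(1), of x] x by blast
        then have xN: "x \<notin> N" using XY(1) X[OF XY(4), of x] n xz by blast
        have "is_clique V (- E) {z, x}" using n z x adj_sym[of E z x] by (auto simp: is_clique_iff)
        then obtain A where A: "maximal_clique V (- E) A" "{z, x} \<subseteq> A"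
          using maximal_clique_extends[OF fin] by blast
        have "v \<notin> A" using maximal_cliqueD[OF A(1), of v z] A(2) z by auto
        from tight[OF A(1) this] have m: "maximal_clique N (- E) (A \<inter> N)" .
        have zN: "z \<in> A \<inter> N" using A(2) XY(1,4) by blast
        have "y \<in> A \<inter> N"
        proof (rule maximal_clique_absorb[OF m])
          show "y \<in> N" using y(1) XY(1) by blast
        next
          fix a assume a: "a \<in> A \<inter> N" "a \<noteq> y"
          have "a \<in> Y"
          proof (cases "a = z")
            case False
            then have "\<not> adj E z a" using maximal_cliqueD[OF m zN a(1)] by simp
            then show ?thesis using X[OF XY(4), of a] False a(1) XY(1) by blast
          qed (use XY(5) in simp)
          then show "adj (- E) y a" using Y[OF y(1), of a] a(2) by simp
        qed
        then have "\<not> adj E y x" using maximal_cliqueD[OF A(1), of y x] A(2) x(2) by simp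
        then show False using x(3) by blast
      qed
      then show "x \<in> nbrs V E z" using x xz by (auto simp: nbrs_def)
    qed (use y yN z Y[OF y(1) XY(5) y(2)] in auto)
    then show ?thesis by blast
  qed
qed

text \<open>
  The excesses of \<open>N(v)\<close> and of the set \<open>M\<close> of non-neighbours, and the numbers of exceptional maximal
  cliques and anticliques (\<open>?C\<close> and \<open>?D\<close> below), sum up to at most 1.  So both contributions vanish
  that are needed for \<open>N(v)\<close> in the graph, or both that are needed for \<open>M\<close> in the complement.
\<close>

lemma dominated_exists:
  assumes fin: "finite V" and two: "card V \<ge> 2"
    and S: "num_max_cliques V E + num_max_cliques V (- E) \<le> card V + 2"
    and IH: "\<And>W. W \<subset> V \<Longrightarrow> W \<noteq> {} \<Longrightarrow>
       num_max_cliques W E + num_max_cliques W (- E) \<le> card W + 1 \<Longrightarrow> K1_like W E"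
  shows "(\<exists>u w. dominated V E u w) \<or> (\<exists>u w. dominated V (- E) u w)"
proof -
  obtain v where v: "v \<in> V" using two by fastforce
  obtain w where w: "w \<in> V" "w \<noteq> v"
    using two v by (metis card_1_singleton_iff card_le_Suc0_iff_eq fin not_less_eq_eq numeral_2_eq_2)
  let ?N = "nbrs V E v" and ?M = "nbrs V (- E) v"
  consider "?N = {}" | "?M = {}" | "?N \<noteq> {}" "?M \<noteq> {}" by blast
  then show ?thesis
  proof cases
    case 1
    then have "dominated V E v w" using v w by (auto simp: dominated_def nbrs_def)
    then show ?thesis by blast
  next
    case 2
    then have "dominated V (- E) v w" using v w by (auto simp: dominated_def nbrs_def)
    then show ?thesis by blast
  next
    case 3
    let ?C = "{K. maximal_clique V E K \<and> v \<notin> K \<and> \<not> maximal_clique ?M E (K \<inter> ?M)}"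
    let ?D = "{K. maximal_clique V (- E) K \<and> v \<notin> K \<and> \<not> maximal_clique ?N (- E) (K \<inter> ?N)}"
    have fCD: "finite ?C" "finite ?D"
      by (rule finite_subset[OF _ finite_maximal_cliques[OF fin]]; blast)+
    have sub: "?N \<subset> V" "?M \<subset> V" using v by (auto simp: nbrs_def)
    have N1: "card ?N + 1 \<le> num_max_cliques ?N E + num_max_cliques ?N (- E)"
      by (rule maximal_clique_sum_ge[OF finite_nbrs[OF fin] 3(1)])
    have M1: "card ?M + 1 \<le> num_max_cliques ?M E + num_max_cliques ?M (- E)"
      by (rule maximal_clique_sum_ge[OF finite_nbrs[OF fin] 3(2)])
    have "num_max_cliques ?N E + num_max_cliques ?M E + card ?C \<le> num_max_cliques V E"
      by (rule num_max_cliques_vertex_split[OF fin v 3(2)])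
    moreover have "num_max_cliques ?M (- E) + num_max_cliques ?N (- E) + card ?D \<le> num_max_cliques V (- E)"
      using num_max_cliques_vertex_split[OF fin v, of "- E"] 3(1) by simp
    moreover have "card V = card ?N + card ?M + 1" by (rule card_nbrs[OF fin v])
    ultimately have "(num_max_cliques ?N E + num_max_cliques ?N (- E) \<le> card ?N + 1 \<and> card ?D = 0) \<or>
      (num_max_cliques ?M E + num_max_cliques ?M (- E) \<le> card ?M + 1 \<and> card ?C = 0)"
      using S N1 M1 by linarith
    then show ?thesis
    proof
      assume a: "num_max_cliques ?N E + num_max_cliques ?N (- E) \<le> card ?N + 1 \<and> card ?D = 0"
      then have D: "?D = {}" using fCD by simp
      show ?thesis
        by (rule dominated_if_nbrs_K1_like[OF fin v IH[OF sub(1) 3(1)]]) (use a D in blast)+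
    next
      assume a: "num_max_cliques ?M E + num_max_cliques ?M (- E) \<le> card ?M + 1 \<and> card ?C = 0"
      then have C: "?C = {}" using fCD by simp
      have "K1_like ?M (- E)" using IH[OF sub(2) 3(2)] a K1_like_compl[of ?M E] by blast
      from dominated_if_nbrs_K1_like[OF fin v this]
      show ?thesis using C unfolding double_compl by blast
    qed
  qed
qed

section \<open>Attaching a vertex to a split graph\<close>

definition split_graph :: "'a set \<Rightarrow> 'a set set \<Rightarrow> bool" where
  "split_graph V E \<longleftrightarrow> (\<exists>X Y. V = X \<union> Y \<and> is_clique V E X \<and> is_clique V (- E) Y)"

lemma split_graphI:
  assumes "V = X \<union> Y" "\<And>a b. a \<in> X \<Longrightarrow> b \<in> X \<Longrightarrow> a \<noteq> b \<Longrightarrow> adj E a b"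
    "\<And>a b. a \<in> Y \<Longrightarrow> b \<in> Y \<Longrightarrow> a \<noteq> b \<Longrightarrow> \<not> adj E a b"
  shows "split_graph V E"
  unfolding split_graph_def by (rule exI[of _ X], rule exI[of _ Y]) (use assms in \<open>auto simp: is_clique_iff\<close>)

lemma split_graph_compl: "split_graph V (- E) \<longleftrightarrow> split_graph V E"
  unfolding split_graph_def by simp (metis Un_commute)

text \<open>
  If in a partition into a clique and an anticlique one part is not maximal, it can absorb a vertex of
  the other part, and then the two parts share this vertex.
\<close>

lemma split_graph_iff: "split_graph V E \<longleftrightarrow> K1_like V E \<or> P4_like V E"
proof
  assume "K1_like V E \<or> P4_like V E"
  then show "split_graph V E"
    unfolding split_graph_def K1_like_def P4_like_def is_anticlique_iff maximal_anticlique_iff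
    using maximal_clique_is_clique by blast
next
  assume "split_graph V E"
  then obtain X Y where XY: "V = X \<union> Y" "is_clique V E X" "is_clique V (- E) Y"
    by (auto simp: split_graph_def)
  have half: "K1_like V F" if S: "V = S \<union> T" "is_clique V F S" "is_clique V (- F) T" "\<not> maximal_clique V F S" for F S T
  proof -
    obtain v where v: "v \<in> V - S" "\<And>x. x \<in> S \<Longrightarrow> adj F v x"
      using S(2,4) unfolding maximal_clique_iff by blast
    then have "\<And>x. x \<in> S \<Longrightarrow> adj F x v" by (metis adj_sym)
    then have "is_clique V F (insert v S)" using S(2) v by (auto simp: is_clique_iff)
    moreover have "v \<in> T" using v(1) S(1) by blast
    moreover have "V = insert v S \<union> T" using S(1) v(1) by blast
    ultimately show ?thesis unfolding K1_like_iff using S(3) by blast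
  qed
  show "K1_like V E \<or> P4_like V E"
  proof (cases "X \<inter> Y = {}")
    case False
    then show ?thesis using XY unfolding K1_like_iff by blast
  next
    case True
    show ?thesis
    proof (cases "maximal_clique V E X \<and> maximal_clique V (- E) Y")
      case True
      then show ?thesis using XY \<open>X \<inter> Y = {}\<close> unfolding P4_like_def maximal_anticlique_iff by blast
    next
      case False
      then consider "\<not> maximal_clique V E X" | "\<not> maximal_clique V (- E) Y" by blast
      then show ?thesis
      proof cases
        case 1
        then show ?thesis using half[OF XY] by blast
      next
        case 2
        have "V = Y \<union> X" using XY(1) by blast
        from half[OF this XY(3) _ 2] XY(2) have "K1_like V (- E)" by simp
        then show ?thesis by (simp add: K1_like_compl)
      qed
    qed
  qed
qed

text \<open>
  If \<open>N(u)\<close> lies in \<open>X\<close>, then \<open>u\<close> joins \<open>Y\<close>.  Otherwise the clique \<open>N(u)\<close> contains a single vertex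
  \<open>y\<close> of \<open>Y\<close>; then \<open>y\<close> moves to \<open>X\<close> and \<open>u\<close> takes its place in \<open>Y\<close>.  This requires \<open>y\<close> to be
  adjacent to the rest of \<open>X\<close>, except for vertices that \<open>X\<close> can leave to \<open>Y\<close>.
\<close>

lemma split_graph_insert_blocked:
  assumes u: "u \<in> V" and XY: "V - {u} = X \<union> Y"
    and X: "\<And>a b. a \<in> X \<Longrightarrow> b \<in> X \<Longrightarrow> a \<noteq> b \<Longrightarrow> adj E a b"
    and Y: "\<And>a b. a \<in> Y \<Longrightarrow> b \<in> Y \<Longrightarrow> a \<noteq> b \<Longrightarrow> \<not> adj E a b"
    and N: "\<And>a b. a \<in> nbrs V E u \<Longrightarrow> b \<in> nbrs V E u \<Longrightarrow> a \<noteq> b \<Longrightarrow> adj E a b"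
    and full: "\<And>x y. y \<in> nbrs V E u \<Longrightarrow> y \<in> Y \<Longrightarrow> y \<notin> X \<Longrightarrow> x \<in> X \<Longrightarrow>
      \<not> adj E x y \<Longrightarrow> \<not> adj E x u \<Longrightarrow> x \<in> Y"
  shows "split_graph V E"
proof (cases "nbrs V E u \<subseteq> X")
  case True
  have "\<not> adj E u a" "\<not> adj E a u" if "a \<in> Y - X" for a
  proof -
    have "a \<notin> nbrs V E u" "a \<in> V" "a \<noteq> u" using that True XY by blast+
    then show "\<not> adj E u a" by (auto simp: nbrs_def)
    then show "\<not> adj E a u" using adj_sym[of E u a] by simp
  qed
  note nu = this
  show ?thesis
    by (rule split_graphI[of V X "insert u (Y - X)"]) (use XY u X Y nu in auto)
next
  case False
  then obtain y where y: "y \<in> nbrs V E u" "y \<notin> X" by blast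
  then have yY: "y \<in> Y" using XY by (auto simp: nbrs_def)
  have uX: "u \<notin> X" "u \<notin> Y" using XY by blast+
  have yu: "adj E u y" "adj E y u" "y \<noteq> u" using y(1) adj_sym[of E u y] by (auto simp: nbrs_def)
  let ?X = "insert y (X - (Y - {y}))" and ?Y = "insert u (Y - {y})"
  have xy: "adj E x y" "adj E y x" if "x \<in> X - (Y - {y})" "x \<noteq> y" for x
  proof -
    show "adj E x y"
    proof (rule ccontr)
      assume n: "\<not> adj E x y"
      have "x \<in> V" using that XY by blast
      have "\<not> adj E x u"
      proof
        assume "adj E x u"
        then have "x \<in> nbrs V E u" using \<open>x \<in> V\<close> that(1) uX adj_sym[of E x u] by (auto simp: nbrs_def)
        then show False using N[OF _ y(1) that(2)] n by blast
      qed
      then show False using full[OF y(1) yY y(2) _ n] that by blast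
    qed
    then show "adj E y x" using adj_sym[of E x y] by simp
  qed
  have uy: "\<not> adj E u a" "\<not> adj E a u" if "a \<in> Y - {y}" for a
  proof -
    show "\<not> adj E u a"
    proof
      assume "adj E u a"
      then have "a \<in> nbrs V E u" using that XY by (auto simp: nbrs_def)
      then show False using N[OF y(1)] Y[OF yY] that by blast
    qed
    then show "\<not> adj E a u" using adj_sym[of E u a] by simp
  qed
  show ?thesis
  proof (rule split_graphI[of V ?X ?Y])
    show "V = ?X \<union> ?Y" using XY u yY by blast
    show "adj E a b" if "a \<in> ?X" "b \<in> ?X" "a \<noteq> b" for a b using that xy X by blast
    show "\<not> adj E a b" if "a \<in> ?Y" "b \<in> ?Y" "a \<noteq> b" for a b using that uy Y by blast
  qed
qed

text \<open>
  A vertex \<open>x \<in> X\<close> adjacent to neither \<open>y\<close> nor \<open>u\<close> would make every maximal anticlique through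
  \<open>u\<close> and \<open>x\<close> a lost one, with \<open>y\<close> replacing \<open>u\<close>.
\<close>

lemma split_graph_insert:
  assumes "finite V" "u \<in> V" "split_graph (V - {u}) E" "lost_cliques V (- E) u = {}"
    and N: "\<And>a b. a \<in> nbrs V E u \<Longrightarrow> b \<in> nbrs V E u \<Longrightarrow> a \<noteq> b \<Longrightarrow> adj E a b"
  shows "split_graph V E"
proof -
  obtain X Y where XY: "V - {u} = X \<union> Y" "is_clique (V - {u}) E X" "is_clique (V - {u}) (- E) Y"
    using assms(3) by (auto simp: split_graph_def)
  have X: "\<And>a b. a \<in> X \<Longrightarrow> b \<in> X \<Longrightarrow> a \<noteq> b \<Longrightarrow> adj E a b"
    and Y: "\<And>a b. a \<in> Y \<Longrightarrow> b \<in> Y \<Longrightarrow> a \<noteq> b \<Longrightarrow> \<not> adj E a b"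
    using XY(2,3) by (auto simp: is_clique_iff)
  show ?thesis
  proof (rule split_graph_insert_blocked[OF assms(2) XY(1) X Y N])
    fix x y assume y: "y \<in> nbrs V E u" "y \<in> Y" "y \<notin> X" and x: "x \<in> X" "\<not> adj E x y" "\<not> adj E x u"
    have "\<not> adj E u x" using x(3) adj_sym[of E x u] by simp
    then have "\<exists>a. a \<in> V \<and> a \<noteq> u \<and> a \<noteq> y \<and> adj E a y \<and> (\<forall>b\<in>{u, x}. a = b \<or> \<not> adj E a b)"
      by (intro blocker_exists[OF assms(1,4) y(1)]) (use x XY(1) assms(2) in auto)
    then obtain a where a: "a \<in> V" "a \<noteq> u" "a \<noteq> y" "adj E a y" "a = x \<or> \<not> adj E a x" by blast
    then have "a \<in> X \<union> Y" using XY(1) by blast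
    then show "x \<in> Y" using a x X Y y(2) by blast
  qed
qed

text \<open>
  One lost anticlique is affordable here, because the common vertex \<open>z\<close> of the two parts already
  provides one: \<open>{u, z}\<close> and \<open>{u, x}\<close> with \<open>x\<close> as before lie in lost anticliques, and these differ
  because \<open>x\<close> and \<open>z\<close> are adjacent.
\<close>

lemma split_graph_insert_K1:
  assumes "finite V" "u \<in> V" "K1_like (V - {u}) E" "card (lost_cliques V (- E) u) \<le> 1"
    and N: "\<And>a b. a \<in> nbrs V E u \<Longrightarrow> b \<in> nbrs V E u \<Longrightarrow> a \<noteq> b \<Longrightarrow> adj E a b"
  shows "split_graph V E"
proof -
  obtain X Y z where XY: "V - {u} = X \<union> Y" "is_clique (V - {u}) E X" "is_clique (V - {u}) (- E) Y" "z \<in> X" "z \<in> Y"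
    using assms(3) by (auto simp: K1_like_iff)
  have X: "\<And>a b. a \<in> X \<Longrightarrow> b \<in> X \<Longrightarrow> a \<noteq> b \<Longrightarrow> adj E a b"
    and Y: "\<And>a b. a \<in> Y \<Longrightarrow> b \<in> Y \<Longrightarrow> a \<noteq> b \<Longrightarrow> \<not> adj E a b"
    using XY(2,3) by (auto simp: is_clique_iff)
  show ?thesis
  proof (rule split_graph_insert_blocked[OF assms(2) XY(1) X Y N])
    fix x y assume y: "y \<in> nbrs V E u" "y \<in> Y" "y \<notin> X" and x: "x \<in> X" "\<not> adj E x y" "\<not> adj E x u"
    show "x \<in> Y"
    proof (rule ccontr)
      assume xY: "x \<notin> Y"
      have yz: "y \<noteq> z" "x \<noteq> z" using y xY XY(4,5) by auto
      have ux: "\<not> adj E u x" using x(3) adj_sym[of E x u] by simp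
      have zV: "z \<in> V" "z \<noteq> u" "x \<in> V" "x \<noteq> u" using XY(1,4) x(1) by blast+
      have uz: "\<not> adj E u z"
      proof
        assume "adj E u z"
        then have "z \<in> nbrs V E u" using zV by (simp add: nbrs_def)
        then show False using N[OF _ y(1)] yz Y[OF XY(5) y(2)] by blast
      qed
      then have zu: "\<not> adj E z u" using adj_sym[of E z u] by simp
      have "\<exists>A \<in> lost_cliques V (- E) u. {u, x} \<subseteq> A"
      proof (rule lost_clique_if_no_blocker[OF assms(1) _ _ y(1)])
        show "is_clique V (- E) {u, x}" using ux x(3) assms(2) zV by (auto simp: is_clique_iff)
        fix a assume a: "a \<in> V" "a \<noteq> u" "a \<noteq> y" "adj E a y" "\<And>b. b \<in> {u, x} \<Longrightarrow> b \<noteq> a \<Longrightarrow> \<not> adj E a b"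
        then have "a \<in> X \<union> Y" using XY(1) by blast
        then show False using a(3,4) a(5)[of x] x X[of a x] Y[of a y] y(2) by blast
      qed simp
      then obtain A1 where A1: "A1 \<in> lost_cliques V (- E) u" "{u, x} \<subseteq> A1" by blast
      have "\<exists>A \<in> lost_cliques V (- E) u. {u, z} \<subseteq> A"
      proof (rule lost_clique_if_no_blocker[OF assms(1) _ _ y(1)])
        show "is_clique V (- E) {u, z}" using uz zu assms(2) zV by (auto simp: is_clique_iff)
        fix a assume a: "a \<in> V" "a \<noteq> u" "a \<noteq> y" "adj E a y" "\<And>b. b \<in> {u, z} \<Longrightarrow> b \<noteq> a \<Longrightarrow> \<not> adj E a b"
        then have "a \<in> X \<union> Y" using XY(1) by blast
        then show False using a(3,4) a(5)[of z] XY(4,5) X[of a z] Y[of a y] y(2) by blast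
      qed simp
      then obtain A2 where A2: "A2 \<in> lost_cliques V (- E) u" "{u, z} \<subseteq> A2" by blast
      have "maximal_clique V (- E) A1" using A1(1) by (simp add: lost_cliques_def)
      then have "z \<notin> A1" using maximal_cliqueD[of V "- E" A1 x z] A1(2) X[OF x(1) XY(4)] yz(2) by auto
      then have "A1 \<noteq> A2" using A2(2) by blast
      then have "card {A1, A2} = 2" by simp
      moreover have "card {A1, A2} \<le> card (lost_cliques V (- E) u)"
        by (rule card_mono[OF finite_lost_cliques[OF assms(1)]]) (use A1 A2 in blast)
      ultimately show False using assms(4) by simp
    qed
  qed
qed

section \<open>The square arises\<close>

text \<open>
  This is where a split graph turns into a \<open>C\<^sub>4\<close>-like one.  The common vertex \<open>z\<close> of \<open>X\<close> and \<open>Y\<close>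
  turns out to be a neighbour of \<open>u\<close>.  Besides \<open>z\<close> there is exactly one neighbour \<open>t\<close> of \<open>u\<close> in \<open>Y\<close>,
  as \<open>N(u)\<close> contains no three pairwise nonadjacent vertices.  A blocker \<open>x \<in> X\<close> for the anticlique
  formed by \<open>u\<close> and the rest of \<open>Y\<close> completes the square \<open>z, x, t, u\<close>.
\<close>

lemma C4_frame_insert_K1:
  assumes fin: "finite V" and u: "u \<in> V" and K1: "K1_like (V - {u}) E"
    and lost: "lost_cliques V (- E) u = {}"
    and two: "num_max_cliques (nbrs V E u) E \<le> 2"
    and nN: "a0 \<in> nbrs V E u" "b0 \<in> nbrs V E u" "a0 \<noteq> b0" "\<not> adj E a0 b0"
  shows "\<exists>p q r s X Y. C4_frame V E p q r s X Y"
proof -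
  obtain X Y z where XY: "V - {u} = X \<union> Y" "is_clique (V - {u}) E X" "is_clique (V - {u}) (- E) Y" "z \<in> X" "z \<in> Y"
    using K1 by (auto simp: K1_like_iff)
  have X: "\<And>a b. a \<in> X \<Longrightarrow> b \<in> X \<Longrightarrow> a \<noteq> b \<Longrightarrow> adj E a b"
    and Y: "\<And>a b. a \<in> Y \<Longrightarrow> b \<in> Y \<Longrightarrow> a \<noteq> b \<Longrightarrow> \<not> adj E a b"
    using XY(2,3) by (auto simp: is_clique_iff)
  have mem: "x \<in> nbrs V E u \<longleftrightarrow> x \<in> X \<union> Y \<and> adj E u x" for x
    unfolding XY(1)[symmetric] by (auto simp: nbrs_def)
  have un: "u \<notin> X" "u \<notin> Y" using XY(1) by blast+
  have sym: "adj E a b \<Longrightarrow> adj E b a" for a b using adj_sym[of E a b] by simp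
  have zV: "z \<in> V" "z \<noteq> u" using XY(1,4) by blast+
  obtain t where t: "t \<in> nbrs V E u" "t \<in> Y" "t \<notin> X"
    using nN X mem by blast
  have tz: "t \<noteq> z" using t(3) XY(4) by blast
  have tu: "adj E u t" "adj E t u" "t \<noteq> u" "t \<in> V" using t(1) sym by (auto simp: nbrs_def)
  (* Otherwise the anticlique {u, z} has no blocker for t: all other non-neighbours of z are in Y. *)
  have uz: "adj E u z"
  proof (rule ccontr)
    assume n: "\<not> adj E u z"
    have "\<exists>a. a \<in> V \<and> a \<noteq> u \<and> a \<noteq> t \<and> adj E a t \<and> (\<forall>b\<in>{u, z}. a = b \<or> \<not> adj E a b)"
      by (rule blocker_exists[OF fin lost t(1)]) (use zV u n sym in auto)
    then obtain a where a: "a \<in> V" "a \<noteq> u" "a \<noteq> t" "adj E a t" "a = z \<or> \<not> adj E a z" by blast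
    then have "a \<in> X \<union> Y" using XY(1) by blast
    then show False using a X Y t(2) XY(4,5) by blast
  qed
  then have zN: "z \<in> nbrs V E u" using zV by (simp add: nbrs_def)
  have one: "y = t" if "y \<in> Y" "y \<noteq> z" "adj E u y" for y
  proof (rule ccontr)
    assume "y \<noteq> t"
    moreover have "y \<in> nbrs V E u" using that mem by blast
    ultimately show False
      using num_max_cliques_le_2D[OF finite_nbrs[OF fin] two, of y t z] that t zN tz Y XY(5) by auto
  qed
  (* Otherwise the anticlique {u, x} has no blocker for t. *)
  have Xt: "adj E x t" if x: "x \<in> X" "\<not> adj E u x" for x
  proof (rule ccontr)
    assume n: "\<not> adj E x t"
    have "\<exists>a. a \<in> V \<and> a \<noteq> u \<and> a \<noteq> t \<and> adj E a t \<and> (\<forall>b\<in>{u, x}. a = b \<or> \<not> adj E a b)"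
      by (rule blocker_exists[OF fin lost t(1)]) (use x un XY(1) u sym in auto)
    then obtain a where a: "a \<in> V" "a \<noteq> u" "a \<noteq> t" "adj E a t" "a = x \<or> \<not> adj E a x" by blast
    then have "a \<in> X \<union> Y" using XY(1) by blast
    then show False using a X Y t(2) x n by blast
  qed
  (* The rest of Y together with u is an anticlique, and z needs a blocker for it. *)
  let ?Y = "Y - {t, z}"
  have uY: "\<not> adj E u y" "\<not> adj E y u" if "y \<in> ?Y" for y using one[of y] that sym by blast+
  have "\<exists>a. a \<in> V \<and> a \<noteq> u \<and> a \<noteq> z \<and> adj E a z \<and> (\<forall>b\<in>insert u ?Y. a = b \<or> \<not> adj E a b)"
    by (rule blocker_exists[OF fin lost zN]) (use uY Y XY(1) u in blast)+
  then obtain x where x: "x \<in> V" "x \<noteq> u" "x \<noteq> z" "adj E x z" "\<And>b. b \<in> insert u ?Y \<Longrightarrow> x = b \<or> \<not> adj E x b"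
    by blast
  have xX: "x \<in> X" "x \<notin> Y" using x XY(1) Y[OF _ XY(5)] by blast+
  have xu: "\<not> adj E x u" "\<not> adj E u x" using x(2) x(5)[of u] sym by blast+
  have xt: "x \<noteq> t" using xX t by blast
  have "C4_frame V E z x t u (X - {z, x} - ?Y) ?Y"
  proof (rule C4_frameI)
    show "z \<noteq> x" "x \<noteq> t" "z \<noteq> t" "z \<noteq> u" "x \<noteq> u" "t \<noteq> u" using x xt tz zV tu by auto
    show "{z, x, t, u} \<inter> (X - {z, x} - ?Y \<union> ?Y) = {}" using xX t un by blast
    show "V = {z, x, t, u} \<union> (X - {z, x} - ?Y) \<union> ?Y" using XY(1,4) xX t u by blast
    show "adj E z x" "adj E z u" "adj E t u" using sym x(4) uz tu by blast+
    show "adj E x t" by (rule Xt[OF xX(1) xu(2)])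
    show "\<not> adj E z t" using Y[OF XY(5) t(2)] tz by blast
    show "\<not> adj E x u" by (rule xu(1))
    show "adj E a b" if "a \<in> X - {z, x} - ?Y" "b \<in> X - {z, x} - ?Y" "a \<noteq> b" for a b using that X by blast
    show "\<not> adj E a b" if "a \<in> ?Y" "b \<in> ?Y" "a \<noteq> b" for a b using that Y by blast
    show "adj E a z \<and> adj E a x \<and> (adj E a t \<or> adj E a u)" if "a \<in> X - {z, x} - ?Y" for a
      using that X XY(4) xX(1) Xt[of a] sym by blast
    show "\<not> adj E y z \<and> \<not> adj E y x \<and> \<not> adj E y t \<and> \<not> adj E y u" if "y \<in> ?Y" for y
      using that Y XY(5) t(2) uY x(5)[of y] xX sym by blast
  qed
  then show ?thesis by blast
qed

section \<open>Attaching a vertex to a graph with a square\<close>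

text \<open>
  Blockers for three anticliques through \<open>u\<close>: for \<open>{u, p}\<close>, if \<open>u\<close> were adjacent to \<open>r\<close>, all
  candidates are adjacent to \<open>p\<close>; for \<open>{u, r} \<union> Y\<close> and the neighbour \<open>p\<close> the blocker can only lie in
  \<open>X\<close>; and for \<open>{u, p, r}\<close>, if \<open>u\<close> were adjacent to a vertex of \<open>Y\<close>, all candidates lie in \<open>X\<close>
  and are adjacent to \<open>p\<close>.
\<close>

lemma C4_frame_insert_blocker:
  assumes fin: "finite V" and u: "u \<in> V" and f: "C4_frame (V - {u}) E p q r s X Y"
    and lost: "lost_cliques V (- E) u = {}"
    and N: "\<And>a b. a \<in> nbrs V E u \<Longrightarrow> b \<in> nbrs V E u \<Longrightarrow> a \<noteq> b \<Longrightarrow> adj E a b"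
  shows "\<not> adj E u r"
    and "adj E u p \<Longrightarrow> \<exists>x\<in>X. adj E x s \<and> \<not> adj E x r \<and> \<not> adj E x u \<and> (\<forall>y\<in>Y. \<not> adj E x y)"
    and "y \<in> Y \<Longrightarrow> \<not> adj E u y"
proof -
  note d = C4_frame_distinct[OF f] and disj = C4_frame_notin[OF f] and V = C4_frame_vertices[OF f]
    and sq = C4_frame_square[OF f] and X = C4_frame_X[OF f] and Y = C4_frame_Y[OF f]
    and XU = C4_frame_XU[OF f] and YU = C4_frame_YU[OF f]
  have mem: "x \<in> nbrs V E u \<longleftrightarrow> x \<in> {p, q, r, s} \<union> X \<union> Y \<and> adj E u x" for x
    unfolding V[symmetric] by (auto simp: nbrs_def)
  have inV: "x \<in> V \<longleftrightarrow> x = u \<or> x \<in> {p, q, r, s} \<union> X \<union> Y" for x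
    unfolding V[symmetric] using u by blast
  have sym: "adj E a b \<Longrightarrow> adj E b a" for a b using adj_sym[of E a b] by simp
  have NE: "\<not> adj E u b" if "adj E u a" "a \<in> {p, q, r, s} \<union> X \<union> Y" "b \<in> {p, q, r, s} \<union> X \<union> Y"
      "a \<noteq> b" "\<not> adj E a b" for a b
    using N[of a b] mem[of a] mem[of b] that by blast
  show r: "\<not> adj E u r"
  proof
    assume ur: "adj E u r"
    have up: "\<not> adj E u p" by (rule NE[OF ur]) (use d sq in auto)
    have "r \<in> nbrs V E u" using ur mem by blast
    from blocker_exists[OF fin lost this, of "{u, p}"]
    obtain a where a: "a \<in> V" "a \<noteq> u" "a \<noteq> r" "adj E a r" "a = p \<or> \<not> adj E a p"
      using up sym inV by blast
    then show False using inV[of a] sq XU YU by blast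
  qed
  have Yu: "\<not> adj E u y" if up: "adj E u p" and y: "y \<in> Y" for y
    by (rule NE[OF up]) (use y disj YU in blast)+
  show "\<exists>x\<in>X. adj E x s \<and> \<not> adj E x r \<and> \<not> adj E x u \<and> (\<forall>y\<in>Y. \<not> adj E x y)" if up: "adj E u p"
  proof -
    have "p \<in> nbrs V E u" using up mem by blast
    moreover have "insert u (insert r Y) \<subseteq> V" using inV by blast
    moreover have "\<not> adj E a b" if "a \<in> insert u (insert r Y)" "b \<in> insert u (insert r Y)" "a \<noteq> b" for a b
      using that r Yu[OF up] YU Y sym by blast
    ultimately obtain a where a: "a \<in> V" "a \<noteq> u" "a \<noteq> p" "adj E a p"
        and ab: "\<And>b. b \<in> insert u (insert r Y) \<Longrightarrow> a = b \<or> \<not> adj E a b"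
      using blocker_exists[OF fin lost, of p "insert u (insert r Y)"] by blast
    have ar: "a = r \<or> \<not> adj E a r" using ab by blast
    have "a \<in> X" using inV[of a] a ar sq YU by blast
    then have "a \<noteq> r" "a \<notin> Y" using disj XU YU by blast+
    then have "\<not> adj E a r" "\<not> adj E a u" "\<forall>y\<in>Y. \<not> adj E a y" using ab a(2) by blast+
    then show ?thesis using \<open>a \<in> X\<close> XU by blast
  qed
  show "\<not> adj E u y" if y: "y \<in> Y"
  proof
    assume uy: "adj E u y"
    have "\<not> adj E u p" "\<not> adj E u r" by (rule NE[OF uy]; use y disj YU in blast)+
    moreover have "y \<in> nbrs V E u" using uy y mem by blast
    ultimately obtain a where a: "a \<in> V" "a \<noteq> u" "a \<noteq> y" "adj E a y" "a = p \<or> \<not> adj E a p"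
      using blocker_exists[OF fin lost, of y "{u, p, r}"] inV sq sym by blast
    then show False using inV[of a] y XU YU Y by blast
  qed
qed

text \<open>
  The square has to be moved.  The vertex \<open>x \<in> X\<close> that the preceding lemma provides is adjacent to
  \<open>p\<close>, \<open>q\<close> and \<open>s\<close> but not to \<open>r\<close>, \<open>u\<close> or any vertex of \<open>Y\<close>, so it can exchange its role with
  \<open>p\<close>.  If \<open>q\<close> is a neighbour of \<open>u\<close> as well, it is exchanged in the same way for a vertex \<open>w\<close>.
  After this \<open>u\<close> has no neighbour in the new square and joins \<open>Y\<close>.
\<close>

lemma C4_frame_insert_nbr:
  assumes fin: "finite V" and u: "u \<in> V" and f: "C4_frame (V - {u}) E p q r s X Y"
    and lost: "lost_cliques V (- E) u = {}"
    and N: "\<And>a b. a \<in> nbrs V E u \<Longrightarrow> b \<in> nbrs V E u \<Longrightarrow> a \<noteq> b \<Longrightarrow> adj E a b"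
    and up: "adj E u p"
  shows "\<exists>p q r s X Y. C4_frame V E p q r s X Y"
proof -
  note d = C4_frame_distinct[OF f] and disj = C4_frame_notin[OF f] and V = C4_frame_vertices[OF f]
    and sq = C4_frame_square[OF f] and X = C4_frame_X[OF f] and Y = C4_frame_Y[OF f]
    and XU = C4_frame_XU[OF f] and YU = C4_frame_YU[OF f]
  have sym: "adj E a b \<Longrightarrow> adj E b a" for a b using adj_sym[of E a b] by simp
  have un: "u \<notin> {p, q, r, s}" "u \<notin> X" "u \<notin> Y" using V by blast+
  have Vu: "V = insert u ({p, q, r, s} \<union> X \<union> Y)" using V u by blast
  note swap = C4_frame_swap[OF f]
  note F = C4_frame_insert_blocker[OF fin u f lost N]
  note G = C4_frame_insert_blocker[OF fin u swap lost N]
  have ur: "\<not> adj E u r" "\<not> adj E r u" and us: "\<not> adj E u s" "\<not> adj E s u" using F(1) G(1) sym by blast+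
  have uY: "\<not> adj E u y" "\<not> adj E y u" if "y \<in> Y" for y using F(3) that sym by blast+
  obtain x where x: "x \<in> X" "adj E x s" "\<not> adj E x r" "\<not> adj E x u" "\<And>y. y \<in> Y \<Longrightarrow> \<not> adj E x y"
    using F(2) up by blast
  have xn: "x \<notin> {p, q, r, s}" "x \<noteq> u" "x \<notin> Y" using x(1) disj un XU YU by blast+
  have xu: "\<not> adj E u x" using x(4) sym by blast
  have xY: "\<And>y. y \<in> Y \<Longrightarrow> \<not> adj E y x" using x(5) sym by blast
  show ?thesis
  proof (cases "adj E u q")
    case False
    have "C4_frame V E x q r s (insert p (X - {x})) (insert u Y)"
    proof (rule C4_frameI)
      show "x \<noteq> q" "q \<noteq> r" "x \<noteq> r" "x \<noteq> s" "q \<noteq> s" "r \<noteq> s" using d xn by auto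
      show "{x, q, r, s} \<inter> (insert p (X - {x}) \<union> insert u Y) = {}" using xn un disj d by auto
      show "V = {x, q, r, s} \<union> insert p (X - {x}) \<union> insert u Y" unfolding Vu using x(1) by blast
      show "adj E x q" "adj E q r" "adj E r s" "adj E x s" "\<not> adj E x r" "\<not> adj E q s" using XU sq x by blast+
      show "adj E a b" if "a \<in> insert p (X - {x})" "b \<in> insert p (X - {x})" "a \<noteq> b" for a b
        using that X XU by blast
      show "\<not> adj E a b" if "a \<in> insert u Y" "b \<in> insert u Y" "a \<noteq> b" for a b using that Y uY by blast
      show "adj E a x \<and> adj E a q \<and> (adj E a r \<or> adj E a s)" if "a \<in> insert p (X - {x})" for a
        using that X x(1) XU sq by blast
      show "\<not> adj E y x \<and> \<not> adj E y q \<and> \<not> adj E y r \<and> \<not> adj E y s" if "y \<in> insert u Y" for y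
        using that YU xY xu False ur us by blast
    qed
    then show ?thesis by blast
  next
    case True
    obtain w where w: "w \<in> X" "adj E w r" "\<not> adj E w s" "\<not> adj E w u" "\<And>y. y \<in> Y \<Longrightarrow> \<not> adj E w y"
      using G(2) True by blast
    have wn: "w \<notin> {p, q, r, s}" "w \<noteq> u" "w \<notin> Y" using w(1) disj un XU YU by blast+
    have wu: "\<not> adj E u w" using w(4) sym by blast
    have wY: "\<And>y. y \<in> Y \<Longrightarrow> \<not> adj E y w" using w(5) sym by blast
    have xw: "x \<noteq> w" using x w by blast
    have "C4_frame V E x w r s ({p, q} \<union> (X - {x, w})) (insert u Y)"
    proof (rule C4_frameI)
      show "x \<noteq> w" "w \<noteq> r" "x \<noteq> r" "x \<noteq> s" "w \<noteq> s" "r \<noteq> s" using d xn wn xw by auto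
      show "{x, w, r, s} \<inter> ({p, q} \<union> (X - {x, w}) \<union> insert u Y) = {}" using xn wn un disj d by auto
      show "V = {x, w, r, s} \<union> ({p, q} \<union> (X - {x, w})) \<union> insert u Y" unfolding Vu using x(1) w(1) by blast
      show "adj E x w" "adj E w r" "adj E r s" "adj E x s" "\<not> adj E x r" "\<not> adj E w s"
        using X x w xw sq by blast+
      show "adj E a b" if "a \<in> {p, q} \<union> (X - {x, w})" "b \<in> {p, q} \<union> (X - {x, w})" "a \<noteq> b" for a b
        using that X XU sq by blast
      show "\<not> adj E a b" if "a \<in> insert u Y" "b \<in> insert u Y" "a \<noteq> b" for a b using that Y uY by blast
      show "adj E a x \<and> adj E a w \<and> (adj E a r \<or> adj E a s)" if "a \<in> {p, q} \<union> (X - {x, w})" for a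
        using that X x(1) w(1) XU sq by blast
      show "\<not> adj E y x \<and> \<not> adj E y w \<and> \<not> adj E y r \<and> \<not> adj E y s" if "y \<in> insert u Y" for y
        using that YU xY xu wY wu ur us by blast
    qed
    then show ?thesis by blast
  qed
qed

text \<open>
  If \<open>u\<close> has no neighbour among \<open>p\<close> and \<open>q\<close>, it has none in the square or in \<open>Y\<close>, and joins \<open>Y\<close>.
\<close>

lemma C4_frame_insert:
  assumes fin: "finite V" and u: "u \<in> V" and f: "C4_frame (V - {u}) E p q r s X Y"
    and lost: "lost_cliques V (- E) u = {}"
    and N: "\<And>a b. a \<in> nbrs V E u \<Longrightarrow> b \<in> nbrs V E u \<Longrightarrow> a \<noteq> b \<Longrightarrow> adj E a b"
  shows "\<exists>p q r s X Y. C4_frame V E p q r s X Y"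
proof -
  note swap = C4_frame_swap[OF f]
  have sym: "adj E a b \<Longrightarrow> adj E b a" for a b using adj_sym[of E a b] by simp
  note F = C4_frame_insert_blocker[OF fin u f lost N]
  note G = C4_frame_insert_blocker[OF fin u swap lost N]
  consider "adj E u p" | "adj E u q" | "\<not> adj E u p" "\<not> adj E u q" by blast
  then show ?thesis
  proof cases
    case 1 then show ?thesis using C4_frame_insert_nbr[OF fin u f lost N] by blast
  next
    case 2 then show ?thesis using C4_frame_insert_nbr[OF fin u swap lost N] by blast
  next
    case 3
    note d = C4_frame_distinct[OF f] and disj = C4_frame_notin[OF f] and V = C4_frame_vertices[OF f]
      and sq = C4_frame_square[OF f] and X = C4_frame_X[OF f] and Y = C4_frame_Y[OF f]
      and XU = C4_frame_XU[OF f] and YU = C4_frame_YU[OF f]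
    have un: "u \<notin> {p, q, r, s}" "u \<notin> X" "u \<notin> Y" using V by blast+
    have uY: "\<not> adj E u y" "\<not> adj E y u" if "y \<in> Y" for y using F(3) that sym by blast+
    have "C4_frame V E p q r s X (insert u Y)"
    proof (rule C4_frameI)
      show "V = {p, q, r, s} \<union> X \<union> insert u Y" using V u by blast
      show "{p, q, r, s} \<inter> (X \<union> insert u Y) = {}" using un disj by blast
      show "\<not> adj E a b" if "a \<in> insert u Y" "b \<in> insert u Y" "a \<noteq> b" for a b using that Y uY by blast
      show "\<not> adj E y p \<and> \<not> adj E y q \<and> \<not> adj E y r \<and> \<not> adj E y s" if "y \<in> insert u Y" for y
        using that YU 3 F(1) G(1) by blast
    qed (use d sq X XU in blast)+
    then show ?thesis by blast
  qed
qed

text \<open>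
  Here the square lives in the complement: in the graph itself, \<open>pr\<close> and \<open>qs\<close> are two disjoint
  edges, \<open>X\<close> is an anticlique and \<open>Y\<close> a clique.  The vertex \<open>u\<close> always joins \<open>X\<close>; if \<open>u\<close> is
  adjacent to \<open>p\<close>, then neither \<open>u\<close> nor a vertex of \<open>X\<close> is adjacent to \<open>r\<close>, and
  \<open>p\<close> and \<open>r\<close> have to be exchanged first.
\<close>

lemma C4_frame_compl_insert_half:
  assumes fin: "finite V" and u: "u \<in> V" and f: "C4_frame (V - {u}) (- E) p q r s X Y"
    and lost: "lost_cliques V (- E) u = {}"
    and N: "\<And>a b. a \<in> nbrs V E u \<Longrightarrow> b \<in> nbrs V E u \<Longrightarrow> a \<noteq> b \<Longrightarrow> adj E a b"
    and uqs: "\<not> adj E u q" "\<not> adj E u s"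
  shows "\<exists>p q r s X Y. C4_frame V (- E) p q r s X Y"
proof -
  note d = C4_frame_distinct[OF f] and disj = C4_frame_notin[OF f] and V = C4_frame_vertices[OF f]
    and sq = C4_frame_square[OF f, simplified] and X = C4_frame_X[OF f, simplified]
    and Y = C4_frame_Y[OF f, simplified]
    and XU = C4_frame_XU[OF f, simplified] and YU = C4_frame_YU[OF f, simplified]
  have mem: "x \<in> nbrs V E u \<longleftrightarrow> x \<in> {p, q, r, s} \<union> X \<union> Y \<and> adj E u x" for x
    unfolding V[symmetric] by (auto simp: nbrs_def)
  have inV: "x \<in> V \<longleftrightarrow> x = u \<or> x \<in> {p, q, r, s} \<union> X \<union> Y" for x
    unfolding V[symmetric] using u by blast
  have sym: "adj E a b \<Longrightarrow> adj E b a" for a b using adj_sym[of E a b] by simp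
  have un: "u \<notin> {p, q, r, s}" "u \<notin> X" "u \<notin> Y" using V by blast+
  have NE: "\<not> adj E u b" if "adj E u a" "a \<in> {p, q, r, s} \<union> X \<union> Y" "b \<in> {p, q, r, s} \<union> X \<union> Y"
      "a \<noteq> b" "\<not> adj E a b" for a b
    using N[of a b] mem[of a] mem[of b] that by blast
  have uX: "\<not> adj E u x" if x: "x \<in> X" for x
  proof
    assume ux: "adj E u x"
    have "\<not> adj E u p" by (rule NE[OF ux]) (use x disj XU in blast)+
    then have "\<not> adj E p u" using sym by blast
    then have B: "\<not> adj E a b" if "a \<in> {u, p, q}" "b \<in> {u, p, q}" "a \<noteq> b" for a b
      using that \<open>\<not> adj E u p\<close> uqs(1) sym[of q u] sq(1,7) by auto
    have "x \<in> nbrs V E u" using ux x mem by blast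
    moreover have "{u, p, q} \<subseteq> V" using inV by simp
    ultimately obtain a where a: "a \<in> V" "a \<noteq> u" "a \<noteq> x" "adj E a x"
        and "\<forall>b\<in>{u, p, q}. a = b \<or> \<not> adj E a b"
      using blocker_exists[OF fin lost, of x "{u, p, q}"] B by blast
    then have ab: "a = p \<or> \<not> adj E a p" "a = q \<or> \<not> adj E a q" by simp_all
    have "a \<notin> X" using X[OF _ x] a(3,4) by blast
    moreover have "a \<notin> Y" using ab(1) YU disj by blast
    moreover have "a \<noteq> p" "a \<noteq> q" using XU(2)[OF x] a(4) by blast+
    moreover have "a \<noteq> r" "a \<noteq> s" using ab \<open>a \<noteq> p\<close> \<open>a \<noteq> q\<close> sq sym by blast+
    ultimately show False using inV[of a] a(1,2) by blast
  qed
  then have Xu: "\<not> adj E x u" if "x \<in> X" for x using that sym by blast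
  show ?thesis
  proof (cases "adj E u p")
    case False
    have "C4_frame V (- E) p q r s (insert u X) Y"
    proof (rule C4_frameI, unfold adj_compl)
      show "V = {p, q, r, s} \<union> insert u X \<union> Y" using V u by blast
      show "{p, q, r, s} \<inter> (insert u X \<union> Y) = {}" using un disj by blast
      show "\<not> adj E a b" if "a \<in> insert u X" "b \<in> insert u X" "a \<noteq> b" for a b using that X uX Xu by blast
      show "\<not> adj E x p \<and> \<not> adj E x q \<and> (\<not> adj E x r \<or> \<not> adj E x s)" if "x \<in> insert u X" for x
        using that XU False uqs by blast
    qed (use d sq Y YU in blast)+
    then show ?thesis by blast
  next
    case up: True
    have pN: "p \<in> nbrs V E u" using up mem by blast
    have BV: "insert u (insert q X) \<subseteq> V" using inV by blast
    have B: "\<not> adj E a b" if "a \<in> insert u (insert q X)" "b \<in> insert u (insert q X)" "a \<noteq> b" for a b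
      using that uqs uX XU X sym by blast
    obtain a where a: "a \<in> V" "a \<noteq> u" "a \<noteq> p" "adj E a p"
        and ab: "\<And>b. b \<in> insert u (insert q X) \<Longrightarrow> a = b \<or> \<not> adj E a b"
      using blocker_exists[OF fin lost pN insertI1 BV B] by blast
    have "a \<notin> Y" using ab[of q] YU disj by blast
    then have "a = r" using inV[of a] a sq XU by blast
    then have ur: "\<not> adj E u r" and Xr: "\<And>x. x \<in> X \<Longrightarrow> \<not> adj E x r"
      using ab a(2) disj sym by blast+
    have "C4_frame V (- E) r q p s (insert u X) Y"
    proof (rule C4_frameI, unfold adj_compl)
      show "V = {r, q, p, s} \<union> insert u X \<union> Y" using V u by blast
      show "{r, q, p, s} \<inter> (insert u X \<union> Y) = {}" using un disj by blast
      show "\<not> adj E a b" if "a \<in> insert u X" "b \<in> insert u X" "a \<noteq> b" for a b using that X uX Xu by blast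
      show "\<not> adj E x r \<and> \<not> adj E x q \<and> (\<not> adj E x p \<or> \<not> adj E x s)" if "x \<in> insert u X" for x
        using that XU Xr ur uqs by blast
    qed (use d sq Y YU in blast)+
    then show ?thesis by blast
  qed
qed

text \<open>
  The neighbours of \<open>u\<close> are pairwise adjacent, so \<open>u\<close> cannot have neighbours on both edges \<open>pr\<close> and
  \<open>qs\<close>; exchanging these edges is a symmetry.
\<close>

lemma C4_frame_compl_insert:
  assumes fin: "finite V" and u: "u \<in> V" and f: "C4_frame (V - {u}) (- E) p q r s X Y"
    and lost: "lost_cliques V (- E) u = {}"
    and N: "\<And>a b. a \<in> nbrs V E u \<Longrightarrow> b \<in> nbrs V E u \<Longrightarrow> a \<noteq> b \<Longrightarrow> adj E a b"
  shows "\<exists>p q r s X Y. C4_frame V (- E) p q r s X Y"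
proof (cases "adj E u q \<or> adj E u s")
  case False
  then show ?thesis using C4_frame_compl_insert_half[OF fin u f lost N] by blast
next
  case True
  note sq = C4_frame_square[OF f, simplified] and d = C4_frame_distinct[OF f]
  have mem: "x \<in> nbrs V E u" if "x \<in> {p, q, r, s}" "adj E u x" for x
    using C4_frame_vertices[OF f] that unfolding nbrs_def by blast
  have "\<not> (adj E u a \<and> adj E u b)" if "a \<in> {p, r}" "b \<in> {q, s}" for a b
    using N[of a b] mem[of a] mem[of b] that sq d by blast
  then have "\<not> adj E u p" "\<not> adj E u r" using True by blast+
  then show ?thesis using C4_frame_compl_insert_half[OF fin u C4_frame_swap[OF f] lost N] by blast
qed

section \<open>The classification\<close>

text \<open>
  The graphs of excess at most 1, as it turns out.
\<close>

definition near_split :: "'a set \<Rightarrow> 'a set set \<Rightarrow> bool" where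
  "near_split V E \<longleftrightarrow> split_graph V E \<or> C4_like V E \<or> C4_like V (- E)"

lemma near_split_compl: "near_split V (- E) \<longleftrightarrow> near_split V E"
  by (auto simp: near_split_def split_graph_compl)

lemma near_split_value:
  assumes "finite V" "near_split V E"
  shows "num_max_cliques V E + num_max_cliques V (- E) = card V + (if K1_like V E then 1 else 2)"
proof (cases "K1_like V E")
  case True
  then show ?thesis using K1_like_value[OF assms(1)] by simp
next
  case False
  then consider "P4_like V E" | "C4_like V E" | "C4_like V (- E)"
    using assms(2) by (auto simp: near_split_def split_graph_iff)
  then show ?thesis
  proof cases
    case 1 then show ?thesis using P4_like_value[OF assms(1)] False by simp
  next
    case 2 then show ?thesis using C4_like_value[OF assms(1)] False by simp
  next
    case 3 then show ?thesis using C4_like_value[OF assms(1), of "- E"] False by simp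
  qed
qed

text \<open>
  The count \<open>sum\<close> distributes an excess of at most 1 over three nonnegative quantities: the excess of
  \<open>V - {u}\<close>, the number of maximal cliques of \<open>N(u)\<close> beyond the first, and the number of lost
  anticliques.  Each case below is one way to do so.
\<close>

lemma near_split_insert_dominated:
  assumes fin: "finite V" and dom: "dominated V E u w"
    and S: "num_max_cliques V E + num_max_cliques V (- E) \<le> card V + 2"
    and IH: "num_max_cliques (V - {u}) E + num_max_cliques (V - {u}) (- E) \<le> card (V - {u}) + 2
      \<Longrightarrow> near_split (V - {u}) E"
  shows "near_split V E"
proof -
  have u: "u \<in> V" and ne: "V - {u} \<noteq> {}" using dom by (auto simp: dominated_def)
  have fu: "finite (V - {u})" using fin by simp
  have cV: "card V = card (V - {u}) + 1" using fin u by (metis Suc_eq_plus1 card_Suc_Diff1)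
  let ?c = "num_max_cliques (nbrs V E u) E"
  let ?S = "num_max_cliques (V - {u}) E + num_max_cliques (V - {u}) (- E)"
  have sum: "?S + ?c + card (lost_cliques V (- E) u) \<le> card (V - {u}) + 3"
    using num_max_cliques_delete_dominated[OF fin dom] num_max_cliques_delete[OF fin u, of "- E"] S cV
    by linarith
  have c1: "1 \<le> ?c" by (rule num_max_cliques_pos[OF finite_nbrs[OF fin]])
  have S1: "card (V - {u}) + 1 \<le> ?S" by (rule maximal_clique_sum_ge[OF fu ne])
  have ns: "near_split (V - {u}) E" by (rule IH) (use sum c1 in linarith)
  note val = near_split_value[OF fu ns]
  show ?thesis
  proof (cases "\<forall>a\<in>nbrs V E u. \<forall>b\<in>nbrs V E u. a \<noteq> b \<longrightarrow> adj E a b")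
    case True
    then have N: "\<And>a b. a \<in> nbrs V E u \<Longrightarrow> b \<in> nbrs V E u \<Longrightarrow> a \<noteq> b \<Longrightarrow> adj E a b" by blast
    show ?thesis
    proof (cases "K1_like (V - {u}) E")
      case K1: True
      have "card (lost_cliques V (- E) u) \<le> 1" using sum c1 S1 by linarith
      then have "split_graph V E" using split_graph_insert_K1[OF fin u K1 _ N] by blast
      then show ?thesis by (simp add: near_split_def)
    next
      case False
      then have "card (lost_cliques V (- E) u) = 0" using sum c1 val by simp
      then have L: "lost_cliques V (- E) u = {}" using finite_lost_cliques[OF fin] by simp
      consider "split_graph (V - {u}) E" | "C4_like (V - {u}) E" | "C4_like (V - {u}) (- E)"
        using ns by (auto simp: near_split_def)
      then show ?thesis
      proof cases
        case 1
        then show ?thesis using split_graph_insert[OF fin u _ L N] by (simp add: near_split_def)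
      next
        case 2
        then obtain p q r s X Y where f: "C4_frame (V - {u}) E p q r s X Y" unfolding C4_like_iff by blast
        then show ?thesis using C4_frame_insert[OF fin u f L N] by (simp add: near_split_def C4_like_iff)
      next
        case 3
        then obtain p q r s X Y where f: "C4_frame (V - {u}) (- E) p q r s X Y" unfolding C4_like_iff by blast
        then show ?thesis using C4_frame_compl_insert[OF fin u f L N] by (simp add: near_split_def C4_like_iff)
      qed
    qed
  next
    case False
    then obtain a b where ab: "a \<in> nbrs V E u" "b \<in> nbrs V E u" "a \<noteq> b" "\<not> adj E a b" by blast
    then have "\<not> ?c \<le> 1" using num_max_cliques_le_1D[OF finite_nbrs[OF fin] _ ab(1-3), of E] by blast
    then have c2: "2 \<le> ?c" by linarith
    then have K1: "K1_like (V - {u}) E" using val sum by (auto split: if_splits)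
    have "?c \<le> 2" "card (lost_cliques V (- E) u) = 0" using sum c2 S1 by linarith+
    then have "\<exists>p q r s X Y. C4_frame V E p q r s X Y"
      using C4_frame_insert_K1[OF fin u K1 _ _ ab] finite_lost_cliques[OF fin] by simp
    then show ?thesis by (simp add: near_split_def C4_like_iff)
  qed
qed

lemma near_split_if_few_maximal_cliques:
  assumes "finite V" "V \<noteq> {}" "num_max_cliques V E + num_max_cliques V (- E) \<le> card V + 2"
  shows "near_split V E"
  using assms
proof (induction "card V" arbitrary: V rule: less_induct)
  case less
  note fin = less(2)
  have IH: "near_split W E"
    if W: "W \<subset> V" "W \<noteq> {}" "num_max_cliques W E + num_max_cliques W (- E) \<le> card W + 2" for W
    by (rule less(1)) (use W fin psubset_card_mono[OF fin W(1)] finite_subset[OF _ fin, of W] in auto)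
  show ?case
  proof (cases "card V \<ge> 2")
    case False
    have "card V \<noteq> 0" using fin less(3) by simp
    then have "card V = 1" using False by linarith
    then obtain v where "V = {v}" by (rule card_1_singletonE)
    then have "split_graph V E" by (intro split_graphI[of V V V]) auto
    then show ?thesis by (simp add: near_split_def)
  next
    case True
    have "(\<exists>u w. dominated V E u w) \<or> (\<exists>u w. dominated V (- E) u w)"
    proof (rule dominated_exists[OF fin True less(4)])
      fix W assume W: "W \<subset> V" "W \<noteq> {}" "num_max_cliques W E + num_max_cliques W (- E) \<le> card W + 1"
      have "near_split W E" using IH W by simp
      moreover have "finite W" using W(1) fin finite_subset by blast
      ultimately show "K1_like W E" using near_split_value[of W E] W(3) by (auto split: if_splits)
    qed
    then show ?thesis
    proof (elim disjE exE)
      fix u w assume dom: "dominated V E u w"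
      then have "V - {u} \<subset> V" "V - {u} \<noteq> {}" by (auto simp: dominated_def)
      then show ?thesis using near_split_insert_dominated[OF fin dom less(4)] IH by blast
    next
      fix u w assume dom: "dominated V (- E) u w"
      then have V: "V - {u} \<subset> V" "V - {u} \<noteq> {}" by (auto simp: dominated_def)
      have "near_split V (- E)"
        by (rule near_split_insert_dominated[OF fin dom])
          (use less(4) IH[OF V] in \<open>simp_all add: add.commute near_split_compl\<close>)
      then show ?thesis by (simp add: near_split_compl)
    qed
  qed
qed

theorem theorem34:
  fixes V :: "'a set" and E :: "'a set set" and n :: nat
  assumes "simple_graph V E" and "card V = n"
  shows "(num_max_cliques V E + num_max_anticliques V E = n + 1 \<longleftrightarrow> K1_like V E) \<and>
         (num_max_cliques V E + num_max_anticliques V E = n + 2 \<longleftrightarrow>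
            P4_like V E \<or> C4_like V E \<or> co_C4_like V E)"
proof -
  have fin: "finite V" "V \<noteq> {}" using assms(1) by (auto simp: simple_graph_def)
  let ?S = "num_max_cliques V E + num_max_cliques V (- E)"
  have few: "near_split V E" if "?S \<le> n + 2"
    using near_split_if_few_maximal_cliques[OF fin] that assms(2) by simp
  have ns: "near_split V E \<longleftrightarrow> K1_like V E \<or> P4_like V E \<or> C4_like V E \<or> co_C4_like V E"
    by (auto simp: near_split_def split_graph_iff co_C4_like_def C4_like_compl_edges)
  have two: "?S = n + 2" if two_like: "P4_like V E \<or> C4_like V E \<or> co_C4_like V E"
  proof -
    from two_like consider "P4_like V E" | "C4_like V E" | "C4_like V (- E)"
      by (auto simp: co_C4_like_def C4_like_compl_edges)
    then show ?thesis
    proof cases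
      case 1 then show ?thesis using P4_like_value[OF fin(1)] assms(2) by simp
    next
      case 2 then show ?thesis using C4_like_value[OF fin(1)] assms(2) by simp
    next
      case 3 then show ?thesis using C4_like_value[OF fin(1), of "- E"] assms(2) by simp
    qed
  qed
  have val: "?S = n + (if K1_like V E then 1 else 2)" if "near_split V E"
    using near_split_value[OF fin(1) that] assms(2) by simp
  have "?S = n + 1 \<longleftrightarrow> K1_like V E"
    using few val ns by (auto split: if_splits)
  moreover have "?S = n + 2 \<longleftrightarrow> P4_like V E \<or> C4_like V E \<or> co_C4_like V E"
  proof
    assume S: "?S = n + 2"
    then have "near_split V E" using few by simp
    moreover from this have "\<not> K1_like V E" using val S by auto
    ultimately show "P4_like V E \<or> C4_like V E \<or> co_C4_like V E" using ns by blast
  qed (rule two)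
  ultimately show ?thesis unfolding num_max_anticliques_eq by blast
qed

end
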